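(* Let $AP(\mathbb Z)\subseteq\ell^\infty(\mathbb Z)$ be the C*-subalgebra generated by $\{x_\lambda:\lambda\in\mathbb T\}$. The $\mathbb Z$-injective envelope $I_{\mathbb Z}(AP(\mathbb Z))$ is strictly contained in $\ell^\infty(\mathbb Z)$ (i.e. it is not all of $\ell^\infty(\mathbb Z)$). Moreover, there is a unital, completely positive, idempotent linear map $\Phi:\ell^\infty(\mathbb Z)\to\ell^\infty(\mathbb Z)$ commuting with the backward shift, whose range is a C*-subalgebra $*$-isomorphic to $I_{\mathbb Z}(AP(\mathbb Z))$, which fixes $AP(\mathbb Z)$ pointwise, annihilates $c_0(\mathbb Z)$, and satisfies $\sigma(\Phi)=\mathbb T$.
   Context: $x_\lambda=(\lambda^n)_{n\in\mathbb Z}$, and $AP(\mathbb Z)$ is the algebra of almost periodic functions on $\mathbb Z$. $\mathbb Z$ acts on $\ell^\infty(\mathbb Z)$ by translation, generated by the backward shift $(Bv)_n=v_{n+1}$; a map is $\mathbb Z$-equivariant if it commutes with this action. A unital C*-algebra (or operator system) with a $\mathbb Z$-action is $\mathbb Z$-injective if every $\mathbb Z$-equivariant completely positive map into it from an equivariant operator subsystem extends equivariantly and completely positively to the larger system; $\ell^\infty(\mathbb Z)$ is $\mathbb Z$-injective. The $\mathbb Z$-injective envelope (Hamana) $I_{\mathbb Z}(\mathcal A)$ of $\mathcal A\subseteq\ell^\infty(\mathbb Z)$ is the range of a minimal $\mathbb Z$-equivariant unital completely positive idempotent on $\ell^\infty(\mathbb Z)$ fixing $\mathcal A$, a minimal $\mathbb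 Z$-injective extension of $\mathcal A$, unique up to equivariant complete order isomorphism fixing $\mathcal A$. For a $\mathbb Z$-equivariant $\Phi$, $\Phi(x_\lambda)=c_\lambda x_\lambda$ and $\sigma(\Phi)=\{\lambda:c_\lambda\ne0\}$. *)

theory Defs
  imports "HOL-Analysis.Analysis"
begin

definition linf :: "(int \<Rightarrow> complex) set" where
  "linf = {f. bounded (range f)}"

definition c0 :: "(int \<Rightarrow> complex) set" where
  "c0 = {f. (f \<longlongrightarrow> 0) cofinite}"

definition xl :: "complex \<Rightarrow> int \<Rightarrow> complex" where
  "xl l = (\<lambda>n. l powi n)"

definition circle :: "complex set" where
  "circle = {l. cmod l = 1}"

definition bshift :: "(int \<Rightarrow> complex) \<Rightarrow> int \<Rightarrow> complex" where
  "bshift v = (\<lambda>n. v (n + 1))"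

definition cstar_sub :: "(int \<Rightarrow> complex) set \<Rightarrow> bool" where
  "cstar_sub B \<longleftrightarrow> B \<subseteq> linf \<and> (\<lambda>_. 1) \<in> B \<and>
     (\<forall>f\<in>B. \<forall>g\<in>B. \<forall>a::complex. (\<lambda>n. a * f n + g n) \<in> B) \<and>
     (\<forall>f\<in>B. \<forall>g\<in>B. (\<lambda>n. f n * g n) \<in> B) \<and>
     (\<forall>f\<in>B. (\<lambda>n. cnj (f n)) \<in> B) \<and>
     (\<forall>F g. (\<forall>k. F k \<in> B) \<and> uniform_limit UNIV F g sequentially \<longrightarrow> g \<in> B)"

definition cstar_gen :: "(int \<Rightarrow> complex) set \<Rightarrow> (int \<Rightarrow> complex) set" where
  "cstar_gen S = \<Inter> {B. S \<subseteq> B \<and> cstar_sub B}"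

definition AP :: "(int \<Rightarrow> complex) set" where
  "AP = cstar_gen (xl ` circle)"

definition psd :: "nat \<Rightarrow> (nat \<Rightarrow> nat \<Rightarrow> complex) \<Rightarrow> bool" where
  "psd n M \<longleftrightarrow> (\<forall>c::nat \<Rightarrow> complex.
      (\<Sum>i<n. \<Sum>j<n. cnj (c i) * M i j * c j) \<in> \<real> \<and>
      0 \<le> Re (\<Sum>i<n. \<Sum>j<n. cnj (c i) * M i j * c j))"

text \<open>Positivity in M_n(ell-infinity(Z)) = ell-infinity(Z, M_n): pointwise psd.\<close>
definition pos_mat :: "nat \<Rightarrow> (nat \<Rightarrow> nat \<Rightarrow> int \<Rightarrow> complex) \<Rightarrow> bool" where
  "pos_mat n F \<longleftrightarrow> (\<forall>i<n. \<forall>j<n. F i j \<in> linf) \<and> (\<forall>k. psd n (\<lambda>i j. F i j k))"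

definition lin_map :: "((int \<Rightarrow> complex) \<Rightarrow> (int \<Rightarrow> complex)) \<Rightarrow> bool" where
  "lin_map \<Phi> \<longleftrightarrow> (\<forall>f\<in>linf. \<Phi> f \<in> linf) \<and>
     (\<forall>f\<in>linf. \<forall>g\<in>linf. \<forall>a::complex. \<Phi> (\<lambda>n. a * f n + g n) = (\<lambda>n. a * \<Phi> f n + \<Phi> g n))"

definition compl_pos :: "((int \<Rightarrow> complex) \<Rightarrow> (int \<Rightarrow> complex)) \<Rightarrow> bool" where
  "compl_pos \<Phi> \<longleftrightarrow> (\<forall>n F. pos_mat n F \<longrightarrow> pos_mat n (\<lambda>i j. \<Phi> (F i j)))"

definition ucp :: "((int \<Rightarrow> complex) \<Rightarrow> (int \<Rightarrow> complex)) \<Rightarrow> bool" where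
  "ucp \<Phi> \<longleftrightarrow> lin_map \<Phi> \<and> \<Phi> (\<lambda>_. 1) = (\<lambda>_. 1) \<and> compl_pos \<Phi>"

definition equivariant :: "((int \<Rightarrow> complex) \<Rightarrow> (int \<Rightarrow> complex)) \<Rightarrow> bool" where
  "equivariant \<Phi> \<longleftrightarrow> (\<forall>f\<in>linf. \<Phi> (bshift f) = bshift (\<Phi> f))"

definition idempotent :: "((int \<Rightarrow> complex) \<Rightarrow> (int \<Rightarrow> complex)) \<Rightarrow> bool" where
  "idempotent \<Phi> \<longleftrightarrow> (\<forall>f\<in>linf. \<Phi> (\<Phi> f) = \<Phi> f)"

definition zproj :: "(int \<Rightarrow> complex) set \<Rightarrow> ((int \<Rightarrow> complex) \<Rightarrow> (int \<Rightarrow> complex)) \<Rightarrow> bool" where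
  "zproj A \<Phi> \<longleftrightarrow> ucp \<Phi> \<and> equivariant \<Phi> \<and> idempotent \<Phi> \<and> (\<forall>a\<in>A. \<Phi> a = a)"

definition proj_le :: "((int \<Rightarrow> complex) \<Rightarrow> (int \<Rightarrow> complex)) \<Rightarrow> ((int \<Rightarrow> complex) \<Rightarrow> (int \<Rightarrow> complex)) \<Rightarrow> bool" where
  "proj_le \<psi> \<phi> \<longleftrightarrow> (\<forall>f\<in>linf. \<psi> (\<phi> f) = \<psi> f \<and> \<phi> (\<psi> f) = \<psi> f)"

definition min_zproj :: "(int \<Rightarrow> complex) set \<Rightarrow> ((int \<Rightarrow> complex) \<Rightarrow> (int \<Rightarrow> complex)) \<Rightarrow> bool" where
  "min_zproj A \<phi> \<longleftrightarrow> zproj A \<phi> \<and>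
     (\<forall>\<psi>. zproj A \<psi> \<and> proj_le \<psi> \<phi> \<longrightarrow> (\<forall>f\<in>linf. \<psi> f = \<phi> f))"

text \<open>The Z-injective envelope I_Z(A), realised as the range of a minimal
  Z-projection psi, carrying the Choi-Effros product psi(f g).  A *-isomorphism
  from this C*-algebra onto a C*-subalgebra R of ell-infinity:\<close>
definition star_iso_env :: "((int \<Rightarrow> complex) \<Rightarrow> (int \<Rightarrow> complex)) \<Rightarrow> (int \<Rightarrow> complex) set \<Rightarrow> bool" where
  "star_iso_env \<psi> R \<longleftrightarrow> (\<exists>\<theta>. bij_betw \<theta> (\<psi> ` linf) R \<and>
     (\<forall>f\<in>\<psi> ` linf. \<forall>g\<in>\<psi> ` linf. \<forall>a::complex.
        \<theta> (\<lambda>n. a * f n + g n) = (\<lambda>n. a * \<theta> f n + \<theta> g n)) \<and>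
     (\<forall>f\<in>\<psi> ` linf. \<theta> (\<lambda>n. cnj (f n)) = (\<lambda>n. cnj (\<theta> f n))) \<and>
     (\<forall>f\<in>\<psi> ` linf. \<forall>g\<in>\<psi> ` linf. \<theta> (\<psi> (\<lambda>n. f n * g n)) = (\<lambda>n. \<theta> f n * \<theta> g n)))"

text \<open>For equivariant Phi, Phi(x_lambda) = c_lambda x_lambda; sigma(Phi) = {lambda in T. c_lambda \<noteq> 0}.\<close>
definition coef :: "((int \<Rightarrow> complex) \<Rightarrow> (int \<Rightarrow> complex)) \<Rightarrow> complex \<Rightarrow> complex" where
  "coef \<Phi> l = (THE c. \<Phi> (xl l) = (\<lambda>n. c * xl l n))"

definition sigma :: "((int \<Rightarrow> complex) \<Rightarrow> (int \<Rightarrow> complex)) \<Rightarrow> complex set" where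
  "sigma \<Phi> = {l \<in> circle. coef \<Phi> l \<noteq> 0}"

end

(* An equivariant unital completely positive map on ell-infinity(Z) is determined by the state
   f |-> Phi(f)(0), and the states whose maps fix AP form a compact convex semigroup in which
   right translations are continuous.  Averaging the powers of an element of a minimal closed
   left ideal shows that every element e of the ideal is rigid, e phi e = e, so e is a minimal
   projection; multiplying by a state that vanishes on c0 makes e vanish on c0 as well.  By the
   Choi-Effros argument, f g - e(f g) is null for f, g in the range of e, hence is killed by any
   character omega in the support of the state e.  The *-endomorphism of ell-infinity induced by
   omega is therefore multiplicative on the range of e for the Choi-Effros product, and it is
   injective there because e omega e = e; the required map is the composition omega e. *)
theory Submission
  imports Defs
begin

text \<open>The obstacle is that the range of a minimal projection \<open>e\<close> need not be
  closed under the pointwise product, so \<open>e\<close> itself cannot serve as the required map;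
  its range has to be moved to an isomorphic copy inside \<open>linf\<close> on which the
  Choi-Effros and the pointwise product agree. Rigidity is what makes this move reversible. The
  identity \<open>e \<phi> e = e\<close> is used for three choices of \<open>\<phi>\<close>:
  evaluation at 0, which gives idempotence of \<open>e\<close>; the state of a competing projection
  below \<open>e\<close>, which gives minimality; and the support character \<open>\<omega>\<close>,
  for which \<open>e\<close> becomes a left inverse. The last choice is legitimate only because the
  map of \<open>\<omega>\<close> fixes \<open>AP\<close> again.\<close>

definition translate :: "int \<Rightarrow> (int \<Rightarrow> complex) \<Rightarrow> int \<Rightarrow> complex" where
  "translate n f = (\<lambda>m. f (m + n))"

text \<open>Equivariance forces \<open>\<Phi> f n = \<Phi> (translate n f) 0\<close>, so an
  equivariant map can be rebuilt from its value at 0 in this way only.\<close>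

definition state_map :: "((int \<Rightarrow> complex) \<Rightarrow> complex) \<Rightarrow> (int \<Rightarrow> complex) \<Rightarrow> int \<Rightarrow> complex" where
  "state_map \<phi> f = (\<lambda>n. \<phi> (translate n f))"

text \<open>An Arens-type product: under \<open>state_map\<close> it becomes composition
  (\<open>state_map_conv\<close>). It is continuous in \<open>\<phi>\<close>, which is evaluated at
  the fixed sequence \<open>state_map \<psi> f\<close>, but in general not in
  \<open>\<psi>\<close>.\<close>

definition conv :: "((int \<Rightarrow> complex) \<Rightarrow> complex) \<Rightarrow> ((int \<Rightarrow> complex) \<Rightarrow> complex)
    \<Rightarrow> (int \<Rightarrow> complex) \<Rightarrow> complex" where
  "conv \<phi> \<psi> = (\<lambda>f. \<phi> (state_map \<psi> f))"

text \<open>Requiring the value \<open>0\<close> outside \<open>linf\<close> makes the set of states compact in the product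
  topology on all functionals.\<close>
definition state :: "((int \<Rightarrow> complex) \<Rightarrow> complex) \<Rightarrow> bool" where
  "state \<phi> \<longleftrightarrow>
     (\<forall>f\<in>linf. \<forall>g\<in>linf. \<forall>a. \<phi> (\<lambda>n. a * f n + g n) = a * \<phi> f + \<phi> g) \<and>
     \<phi> (\<lambda>_. 1) = 1 \<and>
     (\<forall>f\<in>linf. (\<forall>n. f n \<in> \<real>\<^sub>\<ge>\<^sub>0) \<longrightarrow> \<phi> f \<in> \<real>\<^sub>\<ge>\<^sub>0) \<and>
     (\<forall>f. f \<notin> linf \<longrightarrow> \<phi> f = 0)"

section \<open>Bounded sequences and their translates\<close>

lemma linfI: "(\<And>n. cmod (f n) \<le> B) \<Longrightarrow> f \<in> linf"
  unfolding linf_def by (auto simp: bounded_iff)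

lemma linfE:
  assumes "f \<in> linf"
  obtains B where "B \<ge> 0" "\<And>n. cmod (f n) \<le> B"
proof -
  obtain B where B: "\<And>n. cmod (f n) \<le> B"
    using assms unfolding linf_def by (auto simp: bounded_iff)
  moreover have "0 \<le> B"
    using B[of 0] norm_ge_zero order_trans by blast
  ultimately show ?thesis using that by blast
qed

lemma linf_const [simp]: "(\<lambda>_. c) \<in> linf"
  by (rule linfI[of _ "cmod c"]) auto

lemma linf_add [simp]: "f \<in> linf \<Longrightarrow> g \<in> linf \<Longrightarrow> (\<lambda>n. f n + g n) \<in> linf"
  unfolding linf_def by (auto intro: bounded_plus_comp)

lemma linf_mult [simp]:
  assumes "f \<in> linf" "g \<in> linf" shows "(\<lambda>n. f n * g n) \<in> linf"
proof -
  obtain A B where "A \<ge> 0" "\<And>n. cmod (f n) \<le> A" "\<And>n. cmod (g n) \<le> B"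
    using assms by (metis linfE)
  then show ?thesis
    by (intro linfI[of _ "A * B"]) (auto simp: norm_mult intro!: mult_mono)
qed

lemma linf_cnj [simp]: "f \<in> linf \<Longrightarrow> (\<lambda>n. cnj (f n)) \<in> linf"
  unfolding linf_def by (auto simp: bounded_iff)

lemma linf_minus [simp]: "f \<in> linf \<Longrightarrow> (\<lambda>n. - f n) \<in> linf"
  using linf_mult[of "\<lambda>_. -1" f] by simp

lemma linf_diff [simp]: "f \<in> linf \<Longrightarrow> g \<in> linf \<Longrightarrow> (\<lambda>n. f n - g n) \<in> linf"
  using linf_add[of f "\<lambda>n. - g n"] by simp

lemma linf_sum [simp]:
  assumes "\<And>i. i \<in> I \<Longrightarrow> f i \<in> linf" shows "(\<lambda>n. \<Sum>i\<in>I. f i n) \<in> linf"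
  using assms by (induction I rule: infinite_finite_induct) auto

lemma linf_translate_iff [simp]: "translate n f \<in> linf \<longleftrightarrow> f \<in> linf"
proof -
  have "range (translate n f) = range f"
    unfolding translate_def by (auto simp: image_def) (metis diff_add_cancel)
  then show ?thesis by (simp add: linf_def)
qed

lemma translate_apply: "translate n f m = f (m + n)"
  by (simp add: translate_def)

lemma translate_translate [simp]: "translate m (translate n f) = translate (m + n) f"
  by (simp add: translate_def add.assoc)

lemma translate_zero [simp]: "translate 0 f = f"
  by (simp add: translate_def)

lemma translate_state_map: "translate n (state_map \<phi> f) = state_map \<phi> (translate n f)"
  by (simp add: state_map_def translate_def add_ac)

lemma state_map_zero: "state_map \<phi> f 0 = \<phi> f"
  by (simp add: state_map_def)

lemma state_map_conv: "state_map (conv \<phi> \<psi>) f = state_map \<phi> (state_map \<psi> f)"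
  by (simp add: state_map_def conv_def translate_state_map[unfolded state_map_def])

lemma conv_apply: "conv \<phi> \<psi> f = \<phi> (state_map \<psi> f)"
  by (simp add: conv_def)

lemma conv_assoc: "conv \<phi> (conv \<psi> x) = conv (conv \<phi> \<psi>) x"
  by (simp add: fun_eq_iff conv_apply state_map_conv)

lemma nonneg_mult_cnj [simp]: "z * cnj z \<in> \<real>\<^sub>\<ge>\<^sub>0"
  by (simp add: complex_nonneg_Reals_iff)

lemma bshift_eq_translate: "bshift = translate 1"
  by (simp add: fun_eq_iff bshift_def translate_def)

section \<open>States and the maps they generate\<close>

lemma state_lin:
  "state \<phi> \<Longrightarrow> f \<in> linf \<Longrightarrow> g \<in> linf \<Longrightarrow> \<phi> (\<lambda>n. a * f n + g n) = a * \<phi> f + \<phi> g"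
  by (simp add: state_def)

lemma state_one: "state \<phi> \<Longrightarrow> \<phi> (\<lambda>_. 1) = 1"
  by (simp add: state_def)

lemma state_nonneg:
  "state \<phi> \<Longrightarrow> f \<in> linf \<Longrightarrow> (\<And>n. f n \<in> \<real>\<^sub>\<ge>\<^sub>0) \<Longrightarrow> \<phi> f \<in> \<real>\<^sub>\<ge>\<^sub>0"
  by (simp add: state_def)

lemma state_add:
  "state \<phi> \<Longrightarrow> f \<in> linf \<Longrightarrow> g \<in> linf \<Longrightarrow> \<phi> (\<lambda>n. f n + g n) = \<phi> f + \<phi> g"
  using state_lin[of \<phi> f g 1] by simp

lemma state_zero: "state \<phi> \<Longrightarrow> \<phi> (\<lambda>_. 0) = 0"
  using state_add[of \<phi> "\<lambda>_. 0" "\<lambda>_. 0"] by simp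

lemma state_scale:
  "state \<phi> \<Longrightarrow> f \<in> linf \<Longrightarrow> \<phi> (\<lambda>n. a * f n) = a * \<phi> f"
  using state_lin[of \<phi> f "\<lambda>_. 0" a] by (simp add: state_zero)

lemma state_const: "state \<phi> \<Longrightarrow> \<phi> (\<lambda>_. c) = c"
  using state_scale[of \<phi> "\<lambda>_. 1" c] by (simp add: state_one)

lemma state_diff:
  "state \<phi> \<Longrightarrow> f \<in> linf \<Longrightarrow> g \<in> linf \<Longrightarrow> \<phi> (\<lambda>n. f n - g n) = \<phi> f - \<phi> g"
  using state_lin[of \<phi> g f "-1"] by simp

lemma state_sum:
  assumes "state \<phi>" "\<And>i. i \<in> I \<Longrightarrow> f i \<in> linf"
  shows "\<phi> (\<lambda>n. \<Sum>i\<in>I. f i n) = (\<Sum>i\<in>I. \<phi> (f i))"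
  using assms(2)
  by (induction I rule: infinite_finite_induct)
     (auto simp: state_zero[OF assms(1)] state_add[OF assms(1)])

lemma state_real:
  assumes \<phi>: "state \<phi>" and f: "f \<in> linf" "\<And>n. f n \<in> \<real>"
  shows "\<phi> f \<in> \<real>"
proof -
  obtain B where B: "B \<ge> 0" "\<And>n. cmod (f n) \<le> B" using f(1) by (rule linfE) auto
  have "f n + of_real B \<in> \<real>\<^sub>\<ge>\<^sub>0" for n
  proof -
    have "\<bar>Re (f n)\<bar> \<le> B" using B(2)[of n] abs_Re_le_cmod order_trans by blast
    then show ?thesis using f(2)[of n] by (auto simp: complex_nonneg_Reals_iff complex_is_Real_iff)
  qed
  then have "\<phi> (\<lambda>n. f n + of_real B) \<in> \<real>\<^sub>\<ge>\<^sub>0"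
    using f by (intro state_nonneg[OF \<phi>]) auto
  then show ?thesis
    using state_add[OF \<phi> f(1) linf_const[of "of_real B"]] state_const[OF \<phi>]
    by (auto simp: complex_nonneg_Reals_iff complex_is_Real_iff)
qed

lemma state_cnj:
  assumes \<phi>: "state \<phi>" and f: "f \<in> linf"
  shows "\<phi> (\<lambda>n. cnj (f n)) = cnj (\<phi> f)"
proof -
  have "\<phi> (\<lambda>n. f n + cnj (f n)) \<in> \<real>"
    using f by (intro state_real[OF \<phi>]) (auto simp: complex_is_Real_iff)
  then have 1: "\<phi> f + \<phi> (\<lambda>n. cnj (f n)) \<in> \<real>"
    by (simp add: state_add[OF \<phi>] f)
  have "\<phi> (\<lambda>n. \<i> * (f n - cnj (f n))) \<in> \<real>"
    using f by (intro state_real[OF \<phi>]) (auto simp: complex_is_Real_iff)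
  then have 2: "\<i> * (\<phi> f - \<phi> (\<lambda>n. cnj (f n))) \<in> \<real>"
    using f by (simp only: state_scale[OF \<phi>] state_diff[OF \<phi>] linf_diff linf_cnj)
  from 1 2 show ?thesis
    by (auto simp: complex_is_Real_iff complex_eq_iff)
qed

text \<open>Positivity of the variance, that is, of \<open>\<phi>\<close> at
  \<open>|f - \<phi> f|^2\<close>. Read at every coordinate of a \<open>state_map\<close>, it
  becomes the Kadison-Schwarz inequality.\<close>

lemma state_cauchy_schwarz:
  assumes \<phi>: "state \<phi>" and f: "f \<in> linf"
  shows "\<phi> (\<lambda>n. f n * cnj (f n)) - \<phi> f * cnj (\<phi> f) \<in> \<real>\<^sub>\<ge>\<^sub>0"
proof -
  let ?z = "\<phi> f"
  have "\<phi> (\<lambda>n. (f n - ?z) * cnj (f n - ?z)) \<in> \<real>\<^sub>\<ge>\<^sub>0"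
    using f by (intro state_nonneg[OF \<phi>] nonneg_mult_cnj) simp
  moreover have "(\<lambda>n. (f n - ?z) * cnj (f n - ?z))
      = (\<lambda>n. f n * cnj (f n) - (cnj ?z * f n + (?z * cnj (f n) + - (?z * cnj ?z))))"
    by (simp add: fun_eq_iff algebra_simps)
  moreover have "\<phi> (\<lambda>n. f n * cnj (f n) - (cnj ?z * f n + (?z * cnj (f n) + - (?z * cnj ?z))))
      = \<phi> (\<lambda>n. f n * cnj (f n)) - ?z * cnj ?z"
    using f by (simp add: state_diff[OF \<phi>] state_lin[OF \<phi>] state_const[OF \<phi>] state_cnj[OF \<phi>]
            state_scale[OF \<phi>]
          del: mult_minus_left)
  ultimately show ?thesis by simp
qed

text \<open>Cauchy-Schwarz gives the sharp constant for complex \<open>f\<close>: the square of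
  \<open>cmod (\<phi> f)\<close> is at most the value of \<open>\<phi>\<close> at
  \<open>|f|^2\<close>, which is at most \<open>B^2\<close>.\<close>

lemma state_bound:
  assumes \<phi>: "state \<phi>" and B: "\<And>n. cmod (f n) \<le> B"
  shows "cmod (\<phi> f) \<le> B"
proof -
  have f: "f \<in> linf" using B by (rule linfI)
  have B0: "0 \<le> B" using B[of 0] norm_ge_zero order_trans by blast
  have "\<phi> (\<lambda>n. of_real (B\<^sup>2) - f n * cnj (f n)) \<in> \<real>\<^sub>\<ge>\<^sub>0"
  proof (rule state_nonneg[OF \<phi>])
    show "of_real (B\<^sup>2) - f n * cnj (f n) \<in> \<real>\<^sub>\<ge>\<^sub>0" for n
      using power_mono[OF B norm_ge_zero, of n 2]
      by (simp add: complex_nonneg_Reals_iff complex_mult_cnj cmod_power2)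
  qed (use f in \<open>simp del: of_real_power\<close>)
  then have "of_real (B\<^sup>2) - \<phi> (\<lambda>n. f n * cnj (f n)) \<in> \<real>\<^sub>\<ge>\<^sub>0"
    using f by (simp only: state_diff[OF \<phi>] state_const[OF \<phi>] linf_const linf_mult linf_cnj)
  with state_cauchy_schwarz[OF \<phi> f] have "(cmod (\<phi> f))\<^sup>2 \<le> B\<^sup>2"
    by (auto simp: complex_nonneg_Reals_iff complex_mult_cnj cmod_power2)
  then show ?thesis using B0 by (rule power2_le_imp_le)
qed

lemma state_map_linf:
  assumes \<phi>: "state \<phi>" shows "state_map \<phi> f \<in> linf"
proof (cases "f \<in> linf")
  case True
  then obtain B where "\<And>n. cmod (f n) \<le> B" by (rule linfE) auto
  then show ?thesis
    by (intro linfI[of _ B]) (auto simp: state_map_def translate_def intro: state_bound[OF \<phi>])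
next
  case False
  then have "state_map \<phi> f = (\<lambda>_. 0)" using \<phi> by (simp add: state_map_def state_def)
  then show ?thesis by simp
qed

lemma state_translate: "state \<phi> \<Longrightarrow> state (\<lambda>f. \<phi> (translate n f))"
  using linf_translate_iff[of n] unfolding state_def translate_def by simp

lemma state_conv:
  assumes \<phi>: "state \<phi>" and \<psi>: "state \<psi>" shows "state (conv \<phi> \<psi>)"
proof -
  have t: "state (\<lambda>f. state_map \<psi> f n)" for n
    using state_translate[OF \<psi>] by (simp add: state_map_def)
  have lin: "state_map \<psi> (\<lambda>n. a * f n + g n) = (\<lambda>n. a * state_map \<psi> f n + state_map \<psi> g n)"
    if "f \<in> linf" "g \<in> linf" for f g a
    using state_lin[OF t that] by (simp add: fun_eq_iff)
  have one: "state_map \<psi> (\<lambda>_. 1) = (\<lambda>_. 1)" using state_one[OF t] by (simp add: fun_eq_iff)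
  have nonneg: "\<phi> (state_map \<psi> f) \<in> \<real>\<^sub>\<ge>\<^sub>0" if "f \<in> linf" "\<forall>n. f n \<in> \<real>\<^sub>\<ge>\<^sub>0" for f
    using that state_nonneg[OF t] by (intro state_nonneg[OF \<phi>] state_map_linf[OF \<psi>]) auto
  have out: "state_map \<psi> f = (\<lambda>_. 0)" if "f \<notin> linf" for f
    using t that by (simp add: fun_eq_iff state_def)
  show ?thesis
    unfolding state_def conv_def
    using nonneg by (auto simp: lin one out state_lin[OF \<phi>] state_map_linf[OF \<psi>] state_one[OF \<phi>] state_zero[OF \<phi>])
qed

text \<open>Positivity of matrices over \<open>linf\<close> is pointwise, so testing against a
  vector \<open>c\<close> leaves one nonnegative scalar sequence \<open>?u\<close>, to which
  positivity of \<open>\<phi>\<close> applies.\<close>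

lemma ucp_state_map:
  assumes \<phi>: "state \<phi>" shows "ucp (state_map \<phi>)"
proof -
  have t: "state (\<lambda>f. state_map \<phi> f n)" for n
    using state_translate[OF \<phi>] by (simp add: state_map_def)
  have "lin_map (state_map \<phi>)"
    unfolding lin_map_def using state_map_linf[OF \<phi>] state_lin[OF t] by (auto simp: fun_eq_iff)
  moreover have "state_map \<phi> (\<lambda>_. 1) = (\<lambda>_. 1)" using state_one[OF t] by (simp add: fun_eq_iff)
  moreover have "compl_pos (state_map \<phi>)"
    unfolding compl_pos_def
  proof (intro allI impI)
    fix n F assume F: "pos_mat n F"
    have "(\<Sum>i<n. \<Sum>j<n. cnj (c i) * state_map \<phi> (F i j) k * c j) \<in> \<real>\<^sub>\<ge>\<^sub>0" for k and c :: "nat \<Rightarrow> complex"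
    proof -
      let ?u = "\<lambda>m. \<Sum>i<n. \<Sum>j<n. cnj (c i) * c j * F i j m"
      have F': "F i j \<in> linf" if "i < n" "j < n" for i j
        using F that by (simp add: pos_mat_def)
      have "state_map \<phi> ?u k = (\<Sum>i<n. state_map \<phi> (\<lambda>m. \<Sum>j<n. cnj (c i) * c j * F i j m) k)"
        by (rule state_sum[OF t]) (auto intro!: linf_sum linf_mult F')
      also have "\<dots> = (\<Sum>i<n. \<Sum>j<n. state_map \<phi> (\<lambda>m. cnj (c i) * c j * F i j m) k)"
        by (intro sum.cong refl state_sum[OF t]) (auto intro!: linf_mult F')
      also have "\<dots> = (\<Sum>i<n. \<Sum>j<n. cnj (c i) * c j * state_map \<phi> (F i j) k)"
        by (intro sum.cong refl state_scale[OF t]) (auto intro!: F')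
      finally have "state_map \<phi> ?u k = (\<Sum>i<n. \<Sum>j<n. cnj (c i) * c j * state_map \<phi> (F i j) k)" .
      moreover have "state_map \<phi> ?u k \<in> \<real>\<^sub>\<ge>\<^sub>0"
      proof (rule state_nonneg[OF t])
        show "?u \<in> linf" by (intro linf_sum linf_mult linf_const F') auto
        show "?u m \<in> \<real>\<^sub>\<ge>\<^sub>0" for m
          using F unfolding pos_mat_def psd_def
          by (auto simp: complex_nonneg_Reals_iff complex_is_Real_iff mult_ac)
      qed
      ultimately show ?thesis by (simp add: mult_ac)
    qed
    then show "pos_mat n (\<lambda>i j. state_map \<phi> (F i j))"
      unfolding pos_mat_def psd_def
      using state_map_linf[OF \<phi>] by (auto simp: complex_nonneg_Reals_iff complex_is_Real_iff)
  qed
  ultimately show ?thesis by (simp add: ucp_def)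
qed

lemma equivariant_state_map: "equivariant (state_map \<phi>)"
  by (simp add: equivariant_def bshift_eq_translate translate_state_map)

lemma equivariant_translate:
  assumes \<psi>: "equivariant \<psi>" and f: "f \<in> linf"
  shows "\<psi> (translate n f) = translate n (\<psi> f)"
  using f
proof (induction n arbitrary: f rule: int_induct[where k = 0])
  case base
  then show ?case by simp
next
  case (step1 i)
  have "\<psi> (translate (i + 1) f) = \<psi> (bshift (translate i f))" by (simp add: bshift_eq_translate add.commute)
  also have "\<dots> = bshift (\<psi> (translate i f))" using \<psi> step1 by (simp add: equivariant_def)
  finally show ?case using step1 by (simp add: bshift_eq_translate add.commute)
next
  case (step2 i)
  have "\<psi> (translate i f) = \<psi> (bshift (translate (i - 1) f))" by (simp add: bshift_eq_translate)
  also have "\<dots> = bshift (\<psi> (translate (i - 1) f))" using \<psi> step2 by (simp add: equivariant_def)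
  \<comment> \<open>Translating back by 1 cancels the shift, which gives the induction step towards
    negative integers.\<close>
  finally have "translate (-1) (translate 1 (\<psi> (translate (i - 1) f))) = translate (-1) (translate i (\<psi> f))"
    using step2 by (simp add: bshift_eq_translate)
  then show ?case by simp
qed

text \<open>Brings an arbitrary competitor in the definition of \<open>min_zproj\<close> into the
  semigroup of states, where rigidity applies.\<close>

lemma ucp_equivariant_obtain_state:
  assumes u: "ucp \<psi>" and eq: "equivariant \<psi>"
  obtains \<phi> where "state \<phi>" "\<And>f. f \<in> linf \<Longrightarrow> state_map \<phi> f = \<psi> f"
proof
  let ?\<phi> = "\<lambda>f. if f \<in> linf then \<psi> f 0 else 0"
  have lin: "\<psi> (\<lambda>n. a * f n + g n) = (\<lambda>n. a * \<psi> f n + \<psi> g n)"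
    if "f \<in> linf" "g \<in> linf" for f g a
    using u that by (simp add: ucp_def lin_map_def)
  have nonneg: "\<psi> f k \<in> \<real>\<^sub>\<ge>\<^sub>0" if f: "f \<in> linf" "\<forall>n. f n \<in> \<real>\<^sub>\<ge>\<^sub>0" for f k
  proof -
    have e: "cnj z * w * z = of_real ((cmod z)\<^sup>2) * w" for z w
      by (simp add: complex_norm_square mult_ac del: of_real_power)
    have "pos_mat 1 (\<lambda>i j. f)"
      unfolding pos_mat_def psd_def using f
      by (auto simp: e complex_nonneg_Reals_iff complex_is_Real_iff simp del: of_real_power)
    then have "pos_mat 1 (\<lambda>i j. \<psi> f)"
      using u by (simp add: ucp_def compl_pos_def)
    then have "cnj 1 * \<psi> f k * 1 \<in> \<real> \<and> 0 \<le> Re (cnj 1 * \<psi> f k * 1)"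
      unfolding pos_mat_def psd_def by (auto dest!: spec[of _ k] spec[of _ "\<lambda>_. 1"])
    then show ?thesis by (auto simp: complex_nonneg_Reals_iff complex_is_Real_iff)
  qed
  show "state ?\<phi>"
    unfolding state_def using u by (auto simp: lin nonneg ucp_def)
  show "state_map ?\<phi> f = \<psi> f" if "f \<in> linf" for f
    using that by (simp add: state_map_def equivariant_translate[OF eq] translate_apply)
qed

section \<open>Compactness\<close>

text \<open>A product of Hausdorff spaces is Hausdorff. This makes images of compact sets of states
  closed, as \<open>left_ideal\<close> demands.\<close>

lemma compact_imp_closed_fun:
  fixes S :: "('a \<Rightarrow> 'b::metric_space) set"
  assumes "compact S" shows "closed S"
proof -
  have "Hausdorff_space (euclidean :: ('a \<Rightarrow> 'b) topology)"
    by (metis Hausdorff_space_euclidean Hausdorff_space_product_topology euclidean_product_topology)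
  then show ?thesis
    using assms by (metis closed_closedin compactin_euclidean_iff compactin_imp_closedin)
qed

text \<open>Banach-Alaoglu by hand: states lie in a product of discs, compact by Tychonoff, and each
  defining condition involves finitely many coordinates, hence is closed.\<close>

lemma compact_states: "compact {\<phi>. state \<phi>}"
proof -
  \<comment> \<open>Any bound of \<open>f\<close> will do as radius; outside \<open>linf\<close> the
    disc in \<open>?P\<close> shrinks to a point.\<close>
  define r where "r f = (SOME B. f \<in> linf \<longrightarrow> (\<forall>n. cmod (f n) \<le> B))" for f
  have r: "cmod (f n) \<le> r f" if "f \<in> linf" for f n
  proof -
    have "\<exists>B. f \<in> linf \<longrightarrow> (\<forall>n. cmod (f n) \<le> B)" using linfE by metis
    from someI_ex[OF this] that show ?thesis unfolding r_def by blast
  qed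
  let ?P = "PiE UNIV (\<lambda>f. cball 0 (if f \<in> linf then r f else 0)) :: ((int \<Rightarrow> complex) \<Rightarrow> complex) set"
  have "compactin (product_topology (\<lambda>_. euclidean) UNIV) ?P"
    by (subst compactin_PiE) auto
  then have "compact ?P"
    by (simp add: euclidean_product_topology)
  moreover have "closed {\<phi>. state \<phi>}"
  proof -
    have "closed ((\<lambda>\<phi>. \<phi> f) -` \<real>\<^sub>\<ge>\<^sub>0 :: ((int \<Rightarrow> complex) \<Rightarrow> complex) set)" for f
      by (intro closed_vimage continuous_on_product_coordinates closed_nonneg_Reals_complex)
    then show ?thesis
      unfolding state_def Ball_def vimage_def
      by (intro closed_Collect_conj closed_Collect_all closed_Collect_imp open_Collect_const
            closed_Collect_eq continuous_intros continuous_on_product_coordinates)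
  qed
  ultimately have "compact (?P \<inter> {\<phi>. state \<phi>})"
    by (rule compact_Int_closed)
  moreover have "{\<phi>. state \<phi>} \<subseteq> ?P"
    using r state_bound by (auto simp: state_def)
  ultimately show ?thesis by (simp add: Int_absorb1)
qed

section \<open>Characters of \<open>linf\<close>, that is, points of the Stone-Cech compactification
  of the integers\<close>

definition character :: "((int \<Rightarrow> complex) \<Rightarrow> complex) \<Rightarrow> bool" where
  "character \<omega> \<longleftrightarrow> state \<omega> \<and>
     (\<forall>f\<in>linf. \<forall>g\<in>linf. \<omega> (\<lambda>n. f n * g n) = \<omega> f * \<omega> g)"

lemma compact_characters: "compact {\<omega>. character \<omega>}"
proof -
  have "closed {\<omega>. \<forall>f\<in>linf. \<forall>g\<in>linf. \<omega> (\<lambda>n. f n * g n) = \<omega> f * (\<omega> g :: complex)}"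
    unfolding Ball_def
    by (intro closed_Collect_all closed_Collect_imp open_Collect_const closed_Collect_eq
          continuous_intros continuous_on_product_coordinates)
  from compact_Int_closed[OF compact_states this] show ?thesis
    by (simp add: character_def Int_def)
qed

lemma character_eval: "character (\<lambda>f. if f \<in> linf then f n else 0)"
  by (simp add: character_def state_def)

text \<open>Evaluations at integers meet any finitely many of the conditions
  \<open>cmod (\<omega> f) \<le> \<epsilon>\<close>, and compactness of the set of characters then
  meets all of them.\<close>

lemma character_exists:
  assumes approx: "\<And>F \<epsilon>. finite F \<Longrightarrow> F \<subseteq> N \<Longrightarrow> \<epsilon> > 0 \<Longrightarrow> \<exists>n. \<forall>f\<in>F. cmod (f n) < \<epsilon>"
  obtains \<omega> where "character \<omega>" "\<And>f. f \<in> N \<Longrightarrow> \<omega> f = 0"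
proof -
  let ?I = "N \<times> {0::real<..}"
  let ?C = "\<lambda>(f, \<epsilon>). {\<omega>. cmod (\<omega> f) \<le> \<epsilon>}"
  have "{\<omega>. character \<omega>} \<inter> (\<Inter>i\<in>?I. ?C i) \<noteq> {}"
  proof (rule compact_imp_fip_image[OF compact_characters])
    show "closed (?C i)" for i
      by (cases i) (auto intro!: closed_Collect_le continuous_intros)
    fix I' assume I': "finite I'" "I' \<subseteq> ?I"
    \<comment> \<open>The smallest of the finitely many tolerances; 1 keeps the set nonempty when
      \<open>I'\<close> is empty.\<close>
    define \<epsilon> where "\<epsilon> = Min (insert 1 (snd ` I'))"
    have "\<epsilon> > 0" unfolding \<epsilon>_def using I' by (subst Min_gr_iff) auto
    then obtain n where n: "\<forall>f\<in>fst ` I'. cmod (f n) < \<epsilon>"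
      using approx[of "fst ` I'" \<epsilon>] I' by fastforce
    have "cmod (if f \<in> linf then f n else 0) \<le> d" if "(f, d) \<in> I'" for f d
    proof -
      have "\<epsilon> \<le> d" unfolding \<epsilon>_def using that I' by (intro Min_le) force+
      moreover have "cmod (f n) < \<epsilon>" using n that by force
      ultimately show ?thesis using \<open>\<epsilon> > 0\<close> by auto
    qed
    then show "{\<omega>. character \<omega>} \<inter> (\<Inter>i\<in>I'. ?C i) \<noteq> {}"
      using character_eval[of n] by fast
  qed
  then obtain \<omega> where \<omega>: "character \<omega>" "\<And>f \<epsilon>. f \<in> N \<Longrightarrow> \<epsilon> > 0 \<Longrightarrow> cmod (\<omega> f) \<le> \<epsilon>"
    by auto
  have "\<omega> f = 0" if "f \<in> N" for f
    using field_le_epsilon[of "cmod (\<omega> f)" 0] \<omega>(2)[OF that] by simp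
  with \<omega>(1) show ?thesis by (rule that)
qed

text \<open>Seen as a measure on the space of characters, \<open>\<phi>\<close> has a nonempty
  support, and \<open>\<omega>\<close> is a point of it. If finitely many null \<open>f\<close> had
  sum of squares at least \<open>\<epsilon>^2\<close> everywhere, applying \<open>\<phi>\<close>
  would give \<open>0 \<ge> \<epsilon>^2\<close>.\<close>

lemma state_support_character:
  assumes \<phi>: "state \<phi>"
  obtains \<omega> where "character \<omega>"
    "\<And>f. f \<in> linf \<Longrightarrow> \<phi> (\<lambda>n. f n * cnj (f n)) = 0 \<Longrightarrow> \<omega> f = 0"
proof (rule character_exists[of "{f \<in> linf. \<phi> (\<lambda>n. f n * cnj (f n)) = 0}"])
  fix F and \<epsilon> :: real
  assume F: "finite F" "F \<subseteq> {f \<in> linf. \<phi> (\<lambda>n. f n * cnj (f n)) = 0}" and \<epsilon>: "\<epsilon> > 0"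
  show "\<exists>n. \<forall>f\<in>F. cmod (f n) < \<epsilon>"
  proof (rule ccontr)
    assume "\<not> ?thesis"
    then have big: "\<exists>f\<in>F. \<epsilon> \<le> cmod (f n)" for n by (meson not_le)
    let ?s = "\<lambda>n. \<Sum>f\<in>F. f n * cnj (f n)"
    have s: "?s n = of_real (\<Sum>f\<in>F. (cmod (f n))\<^sup>2)" for n
      by (simp add: complex_norm_square del: of_real_power)
    have le: "\<epsilon>\<^sup>2 \<le> (\<Sum>f\<in>F. (cmod (f n))\<^sup>2)" for n
    proof -
      obtain f where f: "f \<in> F" "\<epsilon> \<le> cmod (f n)" using big by blast
      have "\<epsilon>\<^sup>2 \<le> (cmod (f n))\<^sup>2" using f(2) \<epsilon> by (intro power_mono) auto
      also have "\<dots> \<le> (\<Sum>f\<in>F. (cmod (f n))\<^sup>2)"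
        by (rule member_le_sum) (use F f in auto)
      finally show ?thesis .
    qed
    have sl: "?s \<in> linf" using F by (intro linf_sum) auto
    have "\<phi> (\<lambda>n. ?s n - of_real (\<epsilon>\<^sup>2)) \<in> \<real>\<^sub>\<ge>\<^sub>0"
    proof (rule state_nonneg[OF \<phi>])
      show "?s n - of_real (\<epsilon>\<^sup>2) \<in> \<real>\<^sub>\<ge>\<^sub>0" for n
        using le[of n] unfolding s of_real_diff[symmetric] by (simp del: of_real_diff of_real_sum)
    qed (use sl in simp)
    moreover have "\<phi> ?s = 0"
      using F by (subst state_sum[OF \<phi>]) (auto intro!: sum.neutral)
    ultimately have "- of_real (\<epsilon>\<^sup>2) \<in> (\<real>\<^sub>\<ge>\<^sub>0 :: complex set)"
      using state_diff[OF \<phi> sl linf_const[of "of_real (\<epsilon>\<^sup>2)"]] state_const[OF \<phi>] by simp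
    then show False using \<epsilon> by (simp add: complex_nonneg_Reals_iff not_le flip: of_real_power)
  qed
qed (use that in blast)

section \<open>Almost periodic sequences\<close>

lemma state_map_uniform_limit:
  assumes \<phi>: "state \<phi>" and F: "\<And>k. F k \<in> linf" and g: "g \<in> linf"
    and lim: "uniform_limit UNIV F g sequentially"
  shows "uniform_limit UNIV (\<lambda>k. state_map \<phi> (F k)) (state_map \<phi> g) sequentially"
proof (rule uniform_limitI)
  fix e :: real assume e: "e > 0"
  \<comment> \<open>Half of \<open>e\<close>, since \<open>state_bound\<close> only returns a weak
    inequality.\<close>
  then have "\<forall>\<^sub>F k in sequentially. \<forall>n\<in>UNIV. dist (F k n) (g n) < e / 2"
    using lim by (intro uniform_limitD) auto
  then show "\<forall>\<^sub>F k in sequentially. \<forall>n\<in>UNIV. dist (state_map \<phi> (F k) n) (state_map \<phi> g n) < e"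
  proof (rule eventually_mono, intro ballI)
    fix k n assume *: "\<forall>n\<in>UNIV. dist (F k n) (g n) < e / 2"
    have "state_map \<phi> (F k) n - state_map \<phi> g n = \<phi> (\<lambda>m. translate n (F k) m - translate n g m)"
      unfolding state_map_def using F g by (intro state_diff[OF \<phi>, symmetric]) auto
    also have "cmod \<dots> \<le> e / 2"
      by (rule state_bound[OF \<phi>]) (use * in \<open>auto simp: translate_def dist_norm intro: less_imp_le\<close>)
    finally show "dist (state_map \<phi> (F k) n) (state_map \<phi> g n) < e" using e by (simp add: dist_norm)
  qed
qed

lemma linf_uniform_limit:
  assumes F: "\<And>k. F k \<in> linf" and lim: "uniform_limit UNIV F g sequentially"
  shows "g \<in> linf"
proof -
  have "\<forall>\<^sub>F k in sequentially. \<forall>n\<in>UNIV. dist (F k n) (g n) < 1"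
    using lim by (intro uniform_limitD) auto
  then obtain k where k: "\<And>n. dist (F k n) (g n) < 1"
    by (auto simp: eventually_sequentially)
  obtain B where B: "\<And>n. cmod (F k n) \<le> B" using F linfE by metis
  show ?thesis
  proof (rule linfI)
    show "cmod (g n) \<le> B + 1" for n
      using k[of n] B[of n] norm_triangle_ineq2[of "g n" "F k n"]
      by (simp add: dist_norm norm_minus_commute)
  qed
qed

lemma cstar_sub_linf: "cstar_sub linf"
  unfolding cstar_sub_def using linf_uniform_limit by auto

text \<open>Linearity, conjugation and uniform limits come from \<open>\<phi>\<close> being a state,
  so only products have to be supplied. Used for characters, to pass from the generators to
  \<open>AP\<close>, and for the final \<open>\<Phi>\<close>, whose range has to be a
  subalgebra.\<close>

lemma cstar_sub_fixed_points:
  assumes \<phi>: "state \<phi>"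
    and mult: "\<And>f g. f \<in> linf \<Longrightarrow> g \<in> linf \<Longrightarrow> state_map \<phi> f = f \<Longrightarrow> state_map \<phi> g = g
      \<Longrightarrow> state_map \<phi> (\<lambda>n. f n * g n) = (\<lambda>n. f n * g n)"
  shows "cstar_sub {f \<in> linf. state_map \<phi> f = f}"
proof -
  have t: "state (\<lambda>f. state_map \<phi> f n)" for n
    using state_translate[OF \<phi>] by (simp add: state_map_def)
  have "state_map \<phi> g = g"
    if F: "\<And>k. F k \<in> linf" "\<And>k. state_map \<phi> (F k) = F k" and lim: "uniform_limit UNIV F g sequentially" for F g
  proof
    fix n
    have "uniform_limit UNIV (\<lambda>k. state_map \<phi> (F k)) (state_map \<phi> g) sequentially"
      using state_map_uniform_limit[OF \<phi> F(1) linf_uniform_limit[OF F(1) lim] lim] .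
    from tendsto_uniform_limitI[OF this UNIV_I] have "(\<lambda>k. F k n) \<longlonglongrightarrow> state_map \<phi> g n"
      by (simp add: F(2))
    moreover have "(\<lambda>k. F k n) \<longlonglongrightarrow> g n"
      using tendsto_uniform_limitI[OF lim] by simp
    ultimately show "state_map \<phi> g n = g n" by (rule LIMSEQ_unique)
  qed
  note limit = this
  show ?thesis
    unfolding cstar_sub_def
  proof (intro conjI ballI allI impI)
    show "(\<lambda>_. 1) \<in> {f \<in> linf. state_map \<phi> f = f}"
      using state_one[OF t] by (simp add: fun_eq_iff)
    show "(\<lambda>n. a * f n + g n) \<in> {f \<in> linf. state_map \<phi> f = f}"
      if "f \<in> {f \<in> linf. state_map \<phi> f = f}" "g \<in> {f \<in> linf. state_map \<phi> f = f}" for f g a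
      using that state_lin[OF t] by (simp add: fun_eq_iff)
    show "(\<lambda>n. f n * g n) \<in> {f \<in> linf. state_map \<phi> f = f}"
      if "f \<in> {f \<in> linf. state_map \<phi> f = f}" "g \<in> {f \<in> linf. state_map \<phi> f = f}" for f g
      using that mult[of f g] by simp
    show "(\<lambda>n. cnj (f n)) \<in> {f \<in> linf. state_map \<phi> f = f}"
      if "f \<in> {f \<in> linf. state_map \<phi> f = f}" for f
      using that state_cnj[OF t] by (simp add: fun_eq_iff)
    show "g \<in> {f \<in> linf. state_map \<phi> f = f}"
      if "(\<forall>k. F k \<in> {f \<in> linf. state_map \<phi> f = f}) \<and> uniform_limit UNIV F g sequentially" for F g
      using that limit[of F g] linf_uniform_limit[of F g] by blast
  qed blast
qed

lemma xl_add: "l \<in> circle \<Longrightarrow> xl l (m + n) = xl l n * xl l m"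
  unfolding xl_def circle_def by (subst power_int_add) auto

lemma norm_xl: "l \<in> circle \<Longrightarrow> cmod (xl l n) = 1"
  by (simp add: xl_def circle_def norm_power_int)

lemma xl_linf [simp]: "l \<in> circle \<Longrightarrow> xl l \<in> linf"
  by (rule linfI[of _ 1]) (simp add: norm_xl)

lemma xl_0: "xl l 0 = 1"
  by (simp add: xl_def)

lemma xl_in_AP: "l \<in> circle \<Longrightarrow> xl l \<in> AP"
  by (auto simp: AP_def cstar_gen_def)

lemma AP_subset: "cstar_sub B \<Longrightarrow> xl ` circle \<subseteq> B \<Longrightarrow> AP \<subseteq> B"
  by (auto simp: AP_def cstar_gen_def)

lemma AP_linf: "AP \<subseteq> linf"
  by (rule AP_subset[OF cstar_sub_linf]) auto

lemma character_mult:
  assumes "character \<omega>" "f \<in> linf" "g \<in> linf"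
  shows "state_map \<omega> (\<lambda>n. f n * g n) = (\<lambda>n. state_map \<omega> f n * state_map \<omega> g n)"
proof
  fix n
  have "translate n (\<lambda>n. f n * g n) = (\<lambda>m. translate n f m * translate n g m)" by (simp add: translate_def)
  then show "state_map \<omega> (\<lambda>n. f n * g n) n = state_map \<omega> f n * state_map \<omega> g n"
    using assms by (simp add: state_map_def character_def)
qed

text \<open>A translate of \<open>xl l\<close> is a scalar multiple of it, so
  \<open>\<omega> (xl l) = 1\<close> already makes \<open>state_map \<omega>\<close> fix
  \<open>xl l\<close>; multiplicativity carries this to the generated algebra.\<close>

lemma character_fixes_AP:
  assumes \<omega>: "character \<omega>" and 1: "\<And>l. l \<in> circle \<Longrightarrow> \<omega> (xl l) = 1" and a: "a \<in> AP"
  shows "state_map \<omega> a = a"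
proof -
  have s: "state \<omega>" using \<omega> by (simp add: character_def)
  have "state_map \<omega> (xl l) = xl l" if "l \<in> circle" for l
  proof
    fix n
    have "translate n (xl l) = (\<lambda>m. xl l n * xl l m)" using xl_add[OF that] by (simp add: translate_def)
    then show "state_map \<omega> (xl l) n = xl l n"
      using that by (simp add: state_map_def state_scale[OF s] 1)
  qed
  then have "AP \<subseteq> {f \<in> linf. state_map \<omega> f = f}"
    by (intro AP_subset cstar_sub_fixed_points[OF s]) (auto simp: character_mult[OF \<omega>])
  then show ?thesis using a by blast
qed

section \<open>Simultaneous recurrence of powers on the circle\<close>

lemma powers_convergent_subseq:
  assumes "finite F" "F \<subseteq> circle"
  shows "\<exists>r::nat \<Rightarrow> nat. strict_mono r \<and> (\<forall>l\<in>F. convergent (\<lambda>k. l ^ r k))"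
  using assms
proof (induction F)
  case empty
  show ?case by (intro exI[of _ id]) (auto simp: strict_mono_def)
next
  case (insert x F)
  then obtain r where r: "strict_mono r" "\<forall>l\<in>F. convergent (\<lambda>k. l ^ r k)" by auto
  have "\<forall>k. x ^ r k \<in> sphere 0 1"
    using insert.prems by (simp add: circle_def norm_power)
  then obtain z s where s: "strict_mono s" "((\<lambda>k. x ^ r k) \<circ> s) \<longlonglongrightarrow> z"
    using compact_sphere[of "0::complex" 1] unfolding compact_def by meson
  have "convergent (\<lambda>k. l ^ (r \<circ> s) k)" if "l \<in> insert x F" for l
  proof (cases "l = x")
    case True
    then show ?thesis using s(2) by (auto simp: convergent_def o_def)
  next
    case False
    then have "convergent ((\<lambda>k. l ^ r k) \<circ> s)"
      using r(2) that s(1) by (intro convergent_subseq_convergent) auto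
    then show ?thesis by (simp add: o_def)
  qed
  then show ?case using strict_mono_o[OF r(1) s(1)] by blast
qed

text \<open>Two late terms of a convergent subsequence of powers are close, and dividing one by the
  other gives a power close to 1, for all \<open>l \<in> F\<close> at once.\<close>

lemma powers_recurrent:
  assumes F: "finite F" "F \<subseteq> circle" and e: "e > 0"
  shows "\<exists>n\<ge>N. \<forall>l\<in>F. cmod (l ^ n - 1) < e"
proof -
  obtain r where r: "strict_mono r" "\<forall>l\<in>F. convergent (\<lambda>k. l ^ r k)"
    using powers_convergent_subseq[OF F] by blast
  have "\<forall>\<^sub>F M in sequentially. \<forall>l\<in>F. \<forall>m\<ge>M. \<forall>n\<ge>M. dist (l ^ r m) (l ^ r n) < e"
  proof (rule eventually_ball_finite[OF F(1)], rule ballI)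
    fix l assume "l \<in> F"
    then have "Cauchy (\<lambda>k. l ^ r k)" using r(2) by (simp add: Cauchy_convergent_iff)
    then obtain M where "\<forall>m\<ge>M. \<forall>n\<ge>M. dist (l ^ r m) (l ^ r n) < e"
      using e unfolding Cauchy_def by blast
    then show "\<forall>\<^sub>F M in sequentially. \<forall>m\<ge>M. \<forall>n\<ge>M. dist (l ^ r m) (l ^ r n) < e"
      unfolding eventually_sequentially by (meson order_trans)
  qed
  then obtain M where M: "\<And>l m n. l \<in> F \<Longrightarrow> m \<ge> M \<Longrightarrow> n \<ge> M \<Longrightarrow> dist (l ^ r m) (l ^ r n) < e"
    unfolding eventually_sequentially by blast
  \<comment> \<open>Large enough for \<open>n \<ge> M\<close> and, because
    \<open>r n \<ge> n\<close>, for \<open>r n - r M \<ge> N\<close>.\<close>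
  define n where "n = M + r M + N"
  have "n \<le> r n" using r(1) by (rule strict_mono_imp_increasing)
  then have rn: "r n = r M + (r n - r M)" and d: "r n - r M \<ge> N" by (auto simp: n_def)
  have "cmod (l ^ (r n - r M) - 1) < e" if l: "l \<in> F" for l
  proof -
    have "l ^ r n - l ^ r M = l ^ r M * (l ^ (r n - r M) - 1)"
      by (subst rn) (simp only: power_add, simp add: algebra_simps)
    moreover have "cmod (l ^ r M) = 1" using l F by (auto simp: norm_power circle_def)
    ultimately have "cmod (l ^ r n - l ^ r M) = cmod (l ^ (r n - r M) - 1)"
      by (simp add: norm_mult)
    then show ?thesis using M[OF l, of n M] by (simp add: dist_norm n_def)
  qed
  with d show ?thesis by blast
qed

lemma c0_finite:
  assumes "f \<in> c0" "e > 0" shows "finite {n. e \<le> cmod (f n)}"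
proof -
  have "\<forall>\<^sub>F n in cofinite. dist (f n) 0 < e"
    using assms unfolding c0_def by (intro tendstoD) auto
  then show ?thesis by (simp add: eventually_cofinite not_less)
qed

lemma c0_linf: "c0 \<subseteq> linf"
proof
  fix f assume "f \<in> c0"
  then have "finite {n. 1 \<le> cmod (f n)}" by (rule c0_finite) simp
  then have "bounded (f ` {n. 1 \<le> cmod (f n)} \<union> ball 0 1)"
    by (simp add: finite_imp_bounded)
  moreover have "range f \<subseteq> f ` {n. 1 \<le> cmod (f n)} \<union> ball 0 1" by auto
  ultimately show "f \<in> linf" unfolding linf_def using bounded_subset by blast
qed

section \<open>The compact semigroup of states whose maps fix \<open>AP\<close>\<close>

definition AP_states :: "((int \<Rightarrow> complex) \<Rightarrow> complex) set" where
  "AP_states = {\<phi>. state \<phi> \<and> (\<forall>a\<in>AP. state_map \<phi> a = a)}"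

lemma AP_states_state: "\<phi> \<in> AP_states \<Longrightarrow> state \<phi>"
  by (simp add: AP_states_def)

lemma AP_states_AP: "\<phi> \<in> AP_states \<Longrightarrow> a \<in> AP \<Longrightarrow> state_map \<phi> a = a"
  by (simp add: AP_states_def)

lemma compact_AP_states: "compact AP_states"
proof -
  have "closed {\<phi>. \<forall>a\<in>AP. state_map \<phi> a = a}"
    unfolding Ball_def fun_eq_iff[of "state_map _ _"] unfolding state_map_def
    by (intro closed_Collect_all closed_Collect_imp open_Collect_const closed_Collect_eq
          continuous_intros continuous_on_product_coordinates)
  from compact_Int_closed[OF compact_states this] show ?thesis
    by (simp add: AP_states_def Int_def)
qed

lemma AP_states_conv: "\<phi> \<in> AP_states \<Longrightarrow> \<psi> \<in> AP_states \<Longrightarrow> conv \<phi> \<psi> \<in> AP_states"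
  by (simp add: AP_states_def state_conv state_map_conv)

text \<open>Evaluation far out at a time \<open>n\<close> where the relevant \<open>l ^ n\<close>
  are near 1 nearly satisfies any finite set of the conditions: being far out makes members of
  \<open>c0\<close> small, the return to 1 takes care of the \<open>xl l\<close>.\<close>

lemma AP_states_kills_c0:
  obtains \<kappa> where "\<kappa> \<in> AP_states" "\<And>f. f \<in> c0 \<Longrightarrow> state_map \<kappa> f = (\<lambda>_. 0)"
proof -
  let ?A = "(\<lambda>l n. xl l n - 1) ` circle"
  obtain \<omega> where \<omega>: "character \<omega>" "\<And>f. f \<in> c0 \<union> ?A \<Longrightarrow> \<omega> f = 0"
  proof (rule character_exists[of "c0 \<union> ?A"])
    fix F and e :: real
    assume F: "finite F" "F \<subseteq> c0 \<union> ?A" and e: "e > 0"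
    obtain G where G: "finite G" "G \<subseteq> circle" "F \<inter> ?A = (\<lambda>l n. xl l n - 1) ` G"
      using finite_subset_image[of "F \<inter> ?A" "\<lambda>l n. xl l n - 1" circle] F(1) by auto
    have "bdd_above (\<Union>f\<in>F \<inter> c0. {n. e \<le> cmod (f n)})"
      using F(1) c0_finite[OF _ e] by (intro bdd_above_finite) auto
    \<comment> \<open>Past \<open>N\<close>, all members of \<open>F\<close> that lie in
      \<open>c0\<close> are smaller than \<open>e\<close>.\<close>
    then obtain N where N: "\<And>f n. f \<in> F \<Longrightarrow> f \<in> c0 \<Longrightarrow> e \<le> cmod (f n) \<Longrightarrow> n \<le> N"
      unfolding bdd_above_def by blast
    obtain n where n: "n \<ge> nat (N + 1)" "\<forall>l\<in>G. cmod (l ^ n - 1) < e"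
      using powers_recurrent[OF G(1,2) e] by blast
    have "cmod (f (int n)) < e" if f: "f \<in> F" for f
    proof (cases "f \<in> c0")
      case True
      then show ?thesis using N[OF f, of "int n"] n(1) by linarith
    next
      case False
      then obtain l where "l \<in> G" "f = (\<lambda>n. xl l n - 1)" using f F G(3) by blast
      then show ?thesis using n(2) by (simp add: xl_def)
    qed
    then show "\<exists>n. \<forall>f\<in>F. cmod (f n) < e" by blast
  qed (use that in blast)
  have s: "state \<omega>" using \<omega>(1) by (simp add: character_def)
  have "\<omega> (xl l) = 1" if "l \<in> circle" for l
    using \<omega>(2)[of "\<lambda>n. xl l n - 1"] state_diff[OF s xl_linf[OF that] linf_const[of 1]] that
    by (simp add: state_const[OF s])
  then have "\<omega> \<in> AP_states"
    using character_fixes_AP[OF \<omega>(1)] s by (simp add: AP_states_def)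
  moreover have "state_map \<omega> f = (\<lambda>_. 0)" if f: "f \<in> c0" for f
  proof -
    \<comment> \<open>Each coordinate of \<open>state_map \<omega> f\<close> is the value of
      \<open>\<omega>\<close> at a translate of \<open>f\<close>, hence the need for translation
      invariance of \<open>c0\<close>.\<close>
    have "translate n f \<in> c0" for n
    proof -
      have "filterlim (\<lambda>m. m + n) cofinite cofinite"
        unfolding filterlim_iff eventually_cofinite
      proof (intro allI impI)
        fix P :: "int \<Rightarrow> bool" assume "finite {m. \<not> P m}"
        then have "finite ((\<lambda>m. m + n) -` {m. \<not> P m})"
          by (rule finite_vimageI) (simp add: inj_def)
        then show "finite {m. \<not> P (m + n)}" by (simp add: vimage_def)
      qed
      moreover have "filterlim f (nhds 0) cofinite" using f by (simp add: c0_def)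
      ultimately show ?thesis
        unfolding c0_def translate_def mem_Collect_eq by (rule filterlim_compose[rotated])
    qed
    then show ?thesis using \<omega>(2) by (simp add: state_map_def)
  qed
  ultimately show ?thesis by (rule that)
qed

section \<open>A minimal left ideal\<close>

lemma AP_states_nonempty: "AP_states \<noteq> {}"
  using AP_states_kills_c0 by blast

section \<open>Right fixed points by averaging\<close>

lemma AP_states_mean:
  assumes s: "\<And>k. s k \<in> AP_states" and N: "N > 0"
  shows "(\<lambda>f. (\<Sum>k<N. s k f) / of_nat N) \<in> AP_states"
proof -
  have st: "state (s k)" for k using s by (simp add: AP_states_def)
  have "state (\<lambda>f. (\<Sum>k<N. s k f) / of_nat N)"
    unfolding state_def
  proof (intro conjI ballI allI impI)
    fix f assume f: "f \<in> linf" "\<forall>n. f n \<in> \<real>\<^sub>\<ge>\<^sub>0"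
    then have "s k f \<in> \<real>\<^sub>\<ge>\<^sub>0" for k by (intro state_nonneg[OF st]) auto
    then show "(\<Sum>k<N. s k f) / of_nat N \<in> \<real>\<^sub>\<ge>\<^sub>0"
      by (auto simp: complex_nonneg_Reals_iff intro!: sum_nonneg divide_nonneg_nonneg)
  next
    fix f assume "f \<notin> linf"
    then have "s k f = 0" for k using st by (simp add: state_def)
    then show "(\<Sum>k<N. s k f) / of_nat N = 0" by simp
  qed (use N in \<open>simp_all add: state_lin[OF st] state_one[OF st] sum.distrib add_divide_distrib
        flip: sum_distrib_left\<close>)
  moreover have "state_map (\<lambda>f. (\<Sum>k<N. s k f) / of_nat N) a = a" if "a \<in> AP" for a
  proof
    fix n
    have "s k (translate n a) = a n" for k
      using fun_cong[OF AP_states_AP[OF s that]] by (simp add: state_map_def)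
    then show "state_map (\<lambda>f. (\<Sum>k<N. s k f) / of_nat N) a n = a n"
      using N by (simp add: state_map_def)
  qed
  ultimately show ?thesis by (simp add: AP_states_def)
qed

text \<open>Markov-Kakutani for the continuous affine map sending \<open>s\<close> to
  \<open>conv s x\<close>: averages of the powers of \<open>x\<close> are almost fixed because the
  difference telescopes, and compactness turns almost fixed into fixed.\<close>

lemma AP_states_right_fixed_point:
  assumes x: "x \<in> AP_states"
  obtains a where "a \<in> AP_states" "\<And>f. a (state_map x f) = a f"
proof -
  have sx: "state x" using x by (rule AP_states_state)
  \<comment> \<open>Approximate fixedness, uniform over the sequences bounded by \<open>B\<close>.
    It is closed because for each \<open>f\<close> it involves only the coordinates \<open>f\<close>
    and \<open>state_map x f\<close>.\<close>
  let ?C = "\<lambda>N. {s :: (int \<Rightarrow> complex) \<Rightarrow> complex.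
    \<forall>f B. (\<forall>n. cmod (f n) \<le> B) \<longrightarrow> cmod (s (state_map x f) - s f) \<le> 2 * B / real (Suc N)}"
  have "AP_states \<inter> (\<Inter>N\<in>UNIV. ?C N) \<noteq> {}"
  proof (rule compact_imp_fip_image[OF compact_AP_states])
    show "closed (?C N)" for N
      by (intro closed_Collect_all closed_Collect_imp open_Collect_const closed_Collect_le
            continuous_intros continuous_on_product_coordinates)
    fix I :: "nat set" assume I: "finite I"
    \<comment> \<open>At least \<open>N + 1\<close> for every \<open>N \<in> I\<close>, so that one
      mean serves all of \<open>I\<close>.\<close>
    define M where "M = Suc (Max (insert 0 I))"
    \<comment> \<open>\<open>u k\<close> is the power of \<open>x\<close> with exponent
      \<open>k + 1\<close>.\<close>
    define u where "u k f = x ((state_map x ^^ k) f)" for k and f :: "int \<Rightarrow> complex"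
    have uK: "u k \<in> AP_states" for k
    proof (induction k)
      case 0
      then show ?case using x by (simp add: u_def[abs_def])
    next
      case (Suc k)
      have "u (Suc k) = conv (u k) x"
        by (simp only: conv_def u_def[abs_def] funpow_Suc_right o_apply)
      then show ?case using AP_states_conv[OF Suc x] by simp
    qed
    let ?a = "\<lambda>f. (\<Sum>k<M. u k f) / of_nat M"
    have "?a \<in> ?C N" if "N \<in> I" for N
    proof (intro CollectI allI impI)
      fix f :: "int \<Rightarrow> complex" and B assume B: "\<forall>n. cmod (f n) \<le> B"
      have B0: "0 \<le> B" using B norm_ge_zero order_trans by blast
      have ub: "cmod (u k f) \<le> B" for k
        by (rule state_bound[OF AP_states_state[OF uK]]) (use B in blast)
      have "?a (state_map x f) - ?a f = (\<Sum>k<M. u (Suc k) f - u k f) / of_nat M"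
        by (simp only: u_def funpow_Suc_right o_apply sum_subtractf diff_divide_distrib)
      also have "\<dots> = (u M f - u 0 f) / of_nat M"
        by (simp only: sum_lessThan_telescope[of "\<lambda>k. u k f" M])
      also have "cmod \<dots> \<le> (B + B) / real M"
        using norm_triangle_le_diff[of "u M f" "u 0 f" "B + B"] ub[of M] ub[of 0]
        by (simp add: norm_divide divide_right_mono)
      also have "\<dots> \<le> 2 * B / real (Suc N)"
        using that I B0 unfolding M_def by (intro frac_le) auto
      finally show "cmod (?a (state_map x f) - ?a f) \<le> 2 * B / real (Suc N)" .
    qed
    moreover have "?a \<in> AP_states" using uK by (rule AP_states_mean) (simp add: M_def)
    ultimately show "AP_states \<inter> (\<Inter>N\<in>I. ?C N) \<noteq> {}" by blast
  qed
  then obtain a where a: "a \<in> AP_states"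
    "\<And>N f B. (\<forall>n. cmod (f n) \<le> B) \<Longrightarrow> cmod (a (state_map x f) - a f) \<le> 2 * B / real (Suc N)"
    by blast
  have "a (state_map x f) = a f" for f
  proof (cases "f \<in> linf")
    case True
    then obtain B where "\<forall>n. cmod (f n) \<le> B" by (metis linfE)
    then have le: "cmod (a (state_map x f) - a f) \<le> 2 * B * inverse (real (Suc N))" for N
      using a(2) by (simp add: divide_inverse)
    have "(\<lambda>N. 2 * B * inverse (real (Suc N))) \<longlonglongrightarrow> 2 * B * 0"
      by (intro tendsto_intros LIMSEQ_inverse_real_of_nat)
    then have "cmod (a (state_map x f) - a f) \<le> 2 * B * 0"
      by (rule LIMSEQ_le_const) (use le in blast)
    then show ?thesis by simp
  next
    case False
    then have "state_map x f = (\<lambda>_. 0)" using sx by (simp add: state_map_def state_def)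
    then show ?thesis
      using False AP_states_state[OF a(1)] by (simp add: state_zero) (simp add: state_def)
  qed
  with a(1) show ?thesis by (rule that)
qed

section \<open>Closed left ideals and rigidity\<close>

definition left_ideal :: "((int \<Rightarrow> complex) \<Rightarrow> complex) set \<Rightarrow> bool" where
  "left_ideal L \<longleftrightarrow> L \<subseteq> AP_states \<and> closed L \<and> L \<noteq> {} \<and> (\<forall>\<phi>\<in>AP_states. \<forall>\<psi>\<in>L. conv \<phi> \<psi> \<in> L)"

lemma left_idealD:
  assumes "left_ideal L"
  shows "L \<subseteq> AP_states" "closed L" "L \<noteq> {}" "\<phi> \<in> AP_states \<Longrightarrow> \<psi> \<in> L \<Longrightarrow> conv \<phi> \<psi> \<in> L"
  using assms unfolding left_ideal_def by blast+

lemma left_ideal_principal: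
  assumes x: "x \<in> AP_states" shows "left_ideal ((\<lambda>s. conv s x) ` AP_states)"
  unfolding left_ideal_def
proof (intro conjI ballI)
  show "(\<lambda>s. conv s x) ` AP_states \<subseteq> AP_states"
    using AP_states_conv[OF _ x] by blast
  have "continuous_on AP_states (\<lambda>s. conv s x)"
    unfolding conv_def
    by (rule continuous_on_coordinatewise_then_product)
       (rule continuous_on_subset[OF continuous_on_product_coordinates subset_UNIV])
  then show "closed ((\<lambda>s. conv s x) ` AP_states)"
    using compact_AP_states by (rule compact_imp_closed_fun[OF compact_continuous_image])
  show "(\<lambda>s. conv s x) ` AP_states \<noteq> {}"
    using AP_states_nonempty by blast
  fix \<phi> \<psi> assume "\<phi> \<in> AP_states" "\<psi> \<in> (\<lambda>s. conv s x) ` AP_states"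
  then obtain s where s: "s \<in> AP_states" "\<psi> = conv s x" by (elim imageE)
  show "conv \<phi> \<psi> \<in> (\<lambda>s. conv s x) ` AP_states"
    by (rule image_eqI[OF _ AP_states_conv[OF \<open>\<phi> \<in> AP_states\<close> s(1)]]) (simp only: s(2) conv_assoc)
qed

text \<open>Zorn's lemma is applied to complements because it delivers maximal elements; compactness
  of \<open>AP_states\<close> keeps the intersection of a chain of ideals nonempty.\<close>

lemma minimal_left_ideal:
  obtains L where "left_ideal L" "\<And>L'. left_ideal L' \<Longrightarrow> L' \<subseteq> L \<Longrightarrow> L' = L"
proof -
  let ?A = "{U. left_ideal (- U)}"
  have "left_ideal AP_states"
    unfolding left_ideal_def
    using compact_imp_closed_fun[OF compact_AP_states] AP_states_nonempty AP_states_conv by simp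
  then have "- AP_states \<in> ?A" by simp
  then have ne: "?A \<noteq> {}" by blast
  have "\<exists>M\<in>?A. \<forall>X\<in>?A. M \<subseteq> X \<longrightarrow> X = M"
  proof (rule subset_Zorn_nonempty[OF ne])
    fix C assume C: "C \<noteq> {}" "subset.chain ?A C"
    then have CA: "\<And>U. U \<in> C \<Longrightarrow> left_ideal (- U)" by (auto simp: subset_chain_def)
    \<comment> \<open>A finite part of a chain is dominated by one member, whose complement is an
      ideal contained in all the others.\<close>
    have ub: "\<exists>U\<in>C. \<forall>V\<in>I. V \<subseteq> U" if "finite I" "I \<subseteq> C" for I
      using that
    proof (induction I)
      case empty
      then show ?case using C(1) by auto
    next
      case (insert V I)
      then obtain U where "U \<in> C" and U: "\<forall>W\<in>I. W \<subseteq> U" by auto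
      moreover have "V \<in> C" using insert.prems by simp
      moreover have "U \<subseteq> V \<or> V \<subseteq> U"
        using C(2) \<open>V \<in> C\<close> \<open>U \<in> C\<close> by (simp add: subset_chain_def)
      ultimately show ?case
        using U \<open>U \<in> C\<close> by (elim disjE) (rule bexI[of _ V] bexI[of _ U]; auto)+
    qed
    have ne: "AP_states \<inter> (\<Inter>U\<in>C. - U) \<noteq> {}"
    proof (rule compact_imp_fip_image[OF compact_AP_states])
      show "closed (- U)" if "U \<in> C" for U using left_idealD(2)[OF CA[OF that]] .
      fix I assume "finite I" "I \<subseteq> C"
      then have "\<exists>U\<in>C. \<forall>V\<in>I. V \<subseteq> U" by (rule ub)
      then obtain U where U: "U \<in> C" "\<forall>V\<in>I. V \<subseteq> U" by blast
      note U' = CA[OF U(1)]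
      have "- U \<subseteq> AP_states \<inter> (\<Inter>V\<in>I. - V)" using left_idealD(1)[OF U'] U(2) by blast
      then show "AP_states \<inter> (\<Inter>U\<in>I. - U) \<noteq> {}" using left_idealD(3)[OF U'] by blast
    qed
    have "left_ideal (\<Inter>U\<in>C. - U)"
      unfolding left_ideal_def
    proof (intro conjI ballI INT_I)
      obtain U where "U \<in> C" using C(1) by blast
      then show "(\<Inter>U\<in>C. - U) \<subseteq> AP_states" using left_idealD(1)[OF CA] by blast
      show "closed (\<Inter>U\<in>C. - U)" by (intro closed_INT ballI left_idealD(2) CA)
      show "(\<Inter>U\<in>C. - U) \<noteq> {}" using ne by blast
      fix \<phi> \<psi> U assume "\<phi> \<in> AP_states" "\<psi> \<in> (\<Inter>U\<in>C. - U)" "U \<in> C"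
      then show "conv \<phi> \<psi> \<in> - U" using left_idealD(4)[OF CA] by blast
    qed
    moreover have "(\<Inter>U\<in>C. - U) = - \<Union>C" by blast
    ultimately have "left_ideal (- \<Union>C)" by (simp only:)
    then show "\<Union>C \<in> ?A" by simp
  qed
  then obtain M where M: "left_ideal (- M)" "\<And>X. left_ideal (- X) \<Longrightarrow> M \<subseteq> X \<Longrightarrow> X = M"
    by blast
  show ?thesis
  proof (rule that[OF M(1)])
    fix L' assume "left_ideal L'" "L' \<subseteq> - M"
    then have "- L' = M" by (intro M(2)) auto
    then show "L' = - M" by blast
  qed
qed

text \<open>If \<open>a x = a\<close> for \<open>a, x\<close> in a minimal left ideal \<open>L\<close>, then \<open>L = AP_states a\<close> shows that \<open>x\<close> is a
  right identity of \<open>L\<close>; hence every \<open>e \<in> L\<close> satisfies \<open>e \<phi> e = e\<close> for all \<open>\<phi> \<in> AP_states\<close>.\<close>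
lemma rigid_state:
  obtains e where "e \<in> AP_states" "\<And>\<phi> f. \<phi> \<in> AP_states \<Longrightarrow> state_map e (state_map \<phi> (state_map e f)) = state_map e f"
proof -
  obtain L where L: "left_ideal L" "\<And>L'. left_ideal L' \<Longrightarrow> L' \<subseteq> L \<Longrightarrow> L' = L"
    by (rule minimal_left_ideal) blast
  have LK: "L \<subseteq> AP_states" and Lne: "L \<noteq> {}"
    and Lmult: "\<And>\<phi> \<psi>. \<phi> \<in> AP_states \<Longrightarrow> \<psi> \<in> L \<Longrightarrow> conv \<phi> \<psi> \<in> L"
    using L(1) by (auto simp: left_ideal_def)
  have Leq: "(\<lambda>s. conv s x) ` AP_states = L" if x: "x \<in> L" for x
    using x Lmult LK by (intro L(2) left_ideal_principal) auto
  have right_id: "y (state_map x f) = y f" if x: "x \<in> L" and y: "y \<in> L" for x y f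
  proof -
    obtain a where a: "a \<in> AP_states" "\<And>f. a (state_map x f) = a f"
      using AP_states_right_fixed_point x LK by blast
    \<comment> \<open>Here \<open>a = conv a x\<close>, and \<open>L\<close> absorbs on the
      left.\<close>
    have "a \<in> L" using Lmult[OF a(1) x] a(2) by (simp add: conv_def)
    then obtain s where s: "y = conv s a" using Leq y by blast
    have "conv a x = a" using a(2) by (simp add: conv_def)
    then have "state_map a (state_map x f) = state_map a f" by (metis state_map_conv)
    then show ?thesis by (simp add: s conv_def)
  qed
  obtain e where e: "e \<in> L" using Lne by blast
  show ?thesis
  proof (rule that)
    show "e \<in> AP_states" using e LK by blast
    fix \<phi> f assume "\<phi> \<in> AP_states"
    from right_id[OF Lmult[OF this e] e] have "conv e (conv \<phi> e) = e"
      unfolding conv_def[of e] by (simp add: fun_eq_iff)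
    then show "state_map e (state_map \<phi> (state_map e f)) = state_map e f" by (metis state_map_conv)
  qed
qed

text \<open>Rigidity survives the multiplication: \<open>(e \<kappa>) \<phi> (e \<kappa>) = (e
  (\<kappa> \<phi>) e) \<kappa> = e \<kappa>\<close>. The factor \<open>\<kappa>\<close> stands on
  the right because then it acts first and kills \<open>c0\<close>.\<close>

lemma rigid_state_c0:
  obtains e where "e \<in> AP_states" "\<And>\<phi> f. \<phi> \<in> AP_states \<Longrightarrow> state_map e (state_map \<phi> (state_map e f)) = state_map e f"
    "\<And>f. f \<in> c0 \<Longrightarrow> state_map e f = (\<lambda>_. 0)"
proof -
  obtain e where e: "e \<in> AP_states" "\<And>\<phi> f. \<phi> \<in> AP_states \<Longrightarrow> state_map e (state_map \<phi> (state_map e f)) = state_map e f"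
    by (rule rigid_state) blast
  obtain \<kappa> where \<kappa>: "\<kappa> \<in> AP_states" "\<And>f. f \<in> c0 \<Longrightarrow> state_map \<kappa> f = (\<lambda>_. 0)"
    by (rule AP_states_kills_c0) blast
  show ?thesis
  proof (rule that)
    show "(conv e \<kappa>) \<in> AP_states" by (rule AP_states_conv[OF e(1) \<kappa>(1)])
    show "state_map (conv e \<kappa>) (state_map \<phi> (state_map (conv e \<kappa>) f)) = state_map (conv e \<kappa>) f" if "\<phi> \<in> AP_states" for \<phi> f
      using e(2)[OF AP_states_conv[OF \<kappa>(1) that], of "state_map \<kappa> f"] by (simp add: state_map_conv)
    show "state_map (conv e \<kappa>) f = (\<lambda>_. 0)" if "f \<in> c0" for f
      using that AP_states_state[OF e(1)] by (simp add: state_map_conv \<kappa>(2)) (simp add: state_map_def translate_def state_zero)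
  qed
qed

section \<open>The Choi--Effros product\<close>

context
  fixes e
  assumes e: "state e" and idem: "\<And>f. state_map e (state_map e f) = state_map e f"
begin

lemma state_map_state: "state (\<lambda>f. state_map e f n)"
  using state_translate[OF e] by (simp add: state_map_def)

text \<open>Polarising the Kadison--Schwarz inequality \<open>e(|s f + k|\<^sup>2) \<ge> |s f|\<^sup>2\<close> in \<open>s\<close> after applying \<open>e\<close>.\<close>
lemma choi_effros_kernel:
  assumes f: "f \<in> linf" "state_map e f = f" and k: "k \<in> linf" "state_map e k = (\<lambda>_. 0)"
  shows "state_map e (\<lambda>n. cnj (f n) * k n) = (\<lambda>_. 0)"
proof
  fix n
  let ?t = "\<lambda>g. state_map e g n"
  let ?w = "?t (\<lambda>m. cnj (f m) * k m)" and ?d = "?t (\<lambda>m. k m * cnj (k m))"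
  note t = state_map_state
  \<comment> \<open>The term quadratic in \<open>s\<close> cancels because \<open>e\<close> is
    idempotent, leaving a real-affine expression in \<open>s\<close> that stays nonnegative.\<close>
  have ineq: "s * cnj ?w + (cnj s * ?w + ?d) \<in> \<real>\<^sub>\<ge>\<^sub>0" for s
  proof -
    let ?u = "\<lambda>m. s * f m + k m"
    have u: "?u \<in> linf" using f k by simp
    have sf: "(\<lambda>m. s * f m * cnj (s * f m)) \<in> linf" using f(1) by simp
    have Eu: "state_map e ?u m = s * f m" for m
      using state_lin[OF t f(1) k(1)] by (simp add: f(2) k(2))
    have "?t (\<lambda>m. state_map e (\<lambda>m. ?u m * cnj (?u m)) m - s * f m * cnj (s * f m)) \<in> \<real>\<^sub>\<ge>\<^sub>0"
    proof (rule state_nonneg[OF t])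
      show "(\<lambda>m. state_map e (\<lambda>m. ?u m * cnj (?u m)) m - s * f m * cnj (s * f m)) \<in> linf"
        using sf state_map_linf[OF e] by (intro linf_diff) auto
      show "state_map e (\<lambda>m. ?u m * cnj (?u m)) m - s * f m * cnj (s * f m) \<in> \<real>\<^sub>\<ge>\<^sub>0" for m
        using state_cauchy_schwarz[OF t u, of m] unfolding Eu .
    qed
    also have "?t (\<lambda>m. state_map e (\<lambda>m. ?u m * cnj (?u m)) m - s * f m * cnj (s * f m))
        = ?t (\<lambda>m. ?u m * cnj (?u m)) - ?t (\<lambda>m. s * f m * cnj (s * f m))"
      using state_diff[OF t state_map_linf[OF e] sf] by (simp add: idem)
    also have "\<dots> = ?t (\<lambda>m. ?u m * cnj (?u m) - s * f m * cnj (s * f m))"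
      using state_diff[OF t linf_mult[OF u linf_cnj[OF u]] sf] by simp
    also have "(\<lambda>m. ?u m * cnj (?u m) - s * f m * cnj (s * f m))
        = (\<lambda>m. s * cnj (cnj (f m) * k m) + (cnj s * (cnj (f m) * k m) + k m * cnj (k m)))"
      by (simp add: fun_eq_iff algebra_simps)
    also have "?t \<dots> = s * cnj ?w + (cnj s * ?w + ?d)"
    proof -
      have fk: "(\<lambda>m. cnj (f m) * k m) \<in> linf" and kk: "(\<lambda>m. k m * cnj (k m)) \<in> linf"
        using f k by simp_all
      then have "(\<lambda>m. cnj s * (cnj (f m) * k m) + k m * cnj (k m)) \<in> linf" by simp
      from state_lin[OF t linf_cnj[OF fk] this] show ?thesis
        by (simp only: state_cnj[OF t fk] state_lin[OF t fk kk])
    qed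
    finally show ?thesis .
  qed
  have "?w = 0"
  proof (rule ccontr)
    assume w: "?w \<noteq> 0"
    \<comment> \<open>Chosen so that \<open>s = - r w\<close> gives the expression in
      \<open>ineq\<close> the real part -1.\<close>
    define r where "r = (Re ?d + 1) / (2 * (cmod ?w)\<^sup>2)"
    have "Re (- of_real r * ?w * cnj ?w + (cnj (- of_real r * ?w) * ?w + ?d)) \<ge> 0"
      using ineq[of "- of_real r * ?w"] by (simp only: complex_nonneg_Reals_iff)
    also have "- of_real r * ?w * cnj ?w + (cnj (- of_real r * ?w) * ?w + ?d)
        = of_real (- 2 * r * (cmod ?w)\<^sup>2) + ?d"
      by (simp add: complex_norm_square mult_ac del: of_real_power)
    finally have "0 \<le> - 2 * r * (cmod ?w)\<^sup>2 + Re ?d" by simp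
    moreover have "2 * r * (cmod ?w)\<^sup>2 = Re ?d + 1" using w by (simp add: r_def)
    ultimately show False by simp
  qed
  then show "?w = 0" .
qed

lemma state_map_cnj: "f \<in> linf \<Longrightarrow> state_map e (\<lambda>n. cnj (f n)) = (\<lambda>n. cnj (state_map e f n))"
  using state_cnj[OF state_map_state] by (simp add: fun_eq_iff)

text \<open>The difference \<open>b - state_map e b\<close> is in the kernel of the idempotent, and
  \<open>choi_effros_kernel\<close> for the conjugate of \<open>f\<close> says that multiplication
  by \<open>f\<close> keeps it there.\<close>

lemma choi_effros:
  assumes f: "f \<in> linf" "state_map e f = f" and b: "b \<in> linf"
  shows "state_map e (\<lambda>n. f n * state_map e b n) = state_map e (\<lambda>n. f n * b n)"
proof -
  let ?k = "\<lambda>n. b n - state_map e b n"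
  have Eb: "state_map e b \<in> linf" using state_map_linf[OF e] .
  have "state_map e (\<lambda>n. cnj (cnj (f n)) * ?k n) = (\<lambda>_. 0)"
  proof (rule choi_effros_kernel)
    show "state_map e (\<lambda>n. cnj (f n)) = (\<lambda>n. cnj (f n))" using state_map_cnj[OF f(1)] f(2) by simp
    show "state_map e ?k = (\<lambda>_. 0)"
      using state_diff[OF state_map_state b Eb] by (simp add: idem fun_eq_iff)
  qed (use f b Eb in auto)
  moreover have "state_map e (\<lambda>n. f n * b n - f n * state_map e b n) m = state_map e (\<lambda>n. f n * b n) m - state_map e (\<lambda>n. f n * state_map e b n) m" for m
    using f b Eb by (intro state_diff[OF state_map_state]) auto
  ultimately show ?thesis by (simp add: fun_eq_iff right_diff_distrib)
qed

text \<open>With \<open>p = e (f g)\<close>, the square \<open>|h|^2\<close> expands into four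
  terms, each of which \<open>e\<close> sends to \<open>q\<close>, its value at
  \<open>|p|^2\<close>; they cancel in pairs.\<close>

lemma choi_effros_null:
  assumes f: "f \<in> linf" "state_map e f = f" and g: "g \<in> linf" "state_map e g = g"
  defines "h \<equiv> \<lambda>n. f n * g n - state_map e (\<lambda>n. f n * g n) n"
  shows "state_map e (\<lambda>n. h n * cnj (h n)) = (\<lambda>_. 0)"
proof -
  define p where "p = state_map e (\<lambda>n. f n * g n)"
  have p: "p \<in> linf" "state_map e p = p" using state_map_linf[OF e] idem by (simp_all add: p_def)
  have fg: "(\<lambda>n. f n * g n) \<in> linf" using f g by simp
  have cp: "(\<lambda>n. cnj (p n)) \<in> linf" "state_map e (\<lambda>n. cnj (p n)) = (\<lambda>n. cnj (p n))"
    using p state_map_cnj by auto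
  have cfg: "(\<lambda>n. cnj (f n) * cnj (g n)) \<in> linf" using f g by simp
  have Ecfg: "state_map e (\<lambda>n. cnj (f n) * cnj (g n)) = (\<lambda>n. cnj (p n))"
    using state_map_cnj[OF fg] by (simp add: p_def)
  define q where "q = state_map e (\<lambda>n. p n * cnj (p n))"
  have 1: "state_map e (\<lambda>n. p n * (cnj (f n) * cnj (g n))) = q"
    using choi_effros[OF p cfg] by (simp add: Ecfg q_def)
  have 2: "state_map e (\<lambda>n. cnj (p n) * (f n * g n)) = q"
    using choi_effros[OF cp fg] by (simp add: q_def mult.commute flip: p_def)
  have gc: "(\<lambda>n. g n * (cnj (f n) * cnj (g n))) \<in> linf" "(\<lambda>n. g n * cnj (p n)) \<in> linf"
    using f g p by simp_all
  \<comment> \<open>Since \<open>f g\<close> itself need not be fixed by \<open>e\<close>,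
    \<open>choi_effros\<close> is used for \<open>g\<close> and \<open>f\<close> separately to
    replace \<open>cnj (f g)\<close> by \<open>cnj p\<close>.\<close>
  have 3: "state_map e (\<lambda>n. f n * (g n * (cnj (f n) * cnj (g n)))) = q"
  proof -
    have "state_map e (\<lambda>n. f n * (g n * (cnj (f n) * cnj (g n))))
        = state_map e (\<lambda>n. f n * state_map e (\<lambda>n. g n * (cnj (f n) * cnj (g n))) n)"
      using choi_effros[OF f gc(1)] by simp
    also have "state_map e (\<lambda>n. g n * (cnj (f n) * cnj (g n))) = state_map e (\<lambda>n. g n * cnj (p n))"
      using choi_effros[OF g cfg] by (simp add: Ecfg)
    also have "state_map e (\<lambda>n. f n * state_map e (\<lambda>n. g n * cnj (p n)) n) = state_map e (\<lambda>n. f n * (g n * cnj (p n)))"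
      using choi_effros[OF f gc(2)] .
    also have "\<dots> = q" using 2 by (simp add: mult_ac)
    finally show ?thesis .
  qed
  have h: "(\<lambda>n. h n * cnj (h n)) = (\<lambda>n. (f n * (g n * (cnj (f n) * cnj (g n))) - p n * (cnj (f n) * cnj (g n)))
      - (cnj (p n) * (f n * g n) - p n * cnj (p n)))"
    unfolding h_def p_def[symmetric] by (simp add: fun_eq_iff algebra_simps)
  have "state_map e (\<lambda>n. h n * cnj (h n)) m = (q m - q m) - (q m - q m)" for m
    unfolding h using f g p by (simp add: state_diff[OF state_map_state] 1 2 3 q_def[symmetric])
  then show ?thesis by (simp add: fun_eq_iff)
qed

end

section \<open>The envelope inside the bounded sequences\<close>

text \<open>A competitor \<open>\<psi>\<close> below \<open>e\<close> satisfies
  \<open>\<psi> f = e (\<psi> (e f))\<close>, which is \<open>e f\<close> by rigidity applied to the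
  state of \<open>\<psi>\<close>.\<close>

lemma min_zproj_rigid:
  assumes e: "e \<in> AP_states" and rigid: "\<And>\<phi> f. \<phi> \<in> AP_states \<Longrightarrow> state_map e (state_map \<phi> (state_map e f)) = state_map e f"
    and idem: "\<And>f. state_map e (state_map e f) = state_map e f"
  shows "min_zproj AP (state_map e)"
  unfolding min_zproj_def
proof (intro conjI allI impI ballI)
  show "zproj AP (state_map e)"
    using ucp_state_map[OF AP_states_state[OF e]] equivariant_state_map idem AP_states_AP[OF e]
    by (auto simp: zproj_def idempotent_def)
  fix \<psi> f assume \<psi>: "zproj AP \<psi> \<and> proj_le \<psi> (state_map e)" and f: "f \<in> linf"
  then obtain \<phi> where \<phi>: "state \<phi>" "\<And>f. f \<in> linf \<Longrightarrow> state_map \<phi> f = \<psi> f"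
    using ucp_equivariant_obtain_state[of \<psi>] by (auto simp: zproj_def)
  have "\<phi> \<in> AP_states"
    using \<phi> \<psi> AP_linf by (auto simp: AP_states_def zproj_def)
  then have "state_map e (\<psi> (state_map e f)) = state_map e f"
    using rigid[of \<phi> f] state_map_linf[OF AP_states_state[OF e]] by (simp add: \<phi>(2))
  then show "\<psi> f = state_map e f" using \<psi> f by (simp add: proj_le_def)
qed

text \<open>On the circle \<open>|x_l - 1|^2 = 2 - x_l - cnj x_l\<close>, where \<open>e\<close>
  takes the value 0, so \<open>x_l - 1\<close> is null and \<open>\<omega>\<close> takes the value 1
  at \<open>x_l\<close>.\<close>

lemma support_character_in_AP_states:
  assumes e: "e \<in> AP_states" and \<omega>: "character \<omega>"
    and null: "\<And>f. f \<in> linf \<Longrightarrow> e (\<lambda>n. f n * cnj (f n)) = 0 \<Longrightarrow> \<omega> f = 0"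
  shows "\<omega> \<in> AP_states"
proof -
  have s: "state \<omega>" using \<omega> by (simp add: character_def)
  note es = AP_states_state[OF e]
  have "\<omega> (xl l) = 1" if l: "l \<in> circle" for l
  proof -
    have ex: "e (xl l) = 1"
      using fun_cong[OF AP_states_AP[OF e xl_in_AP[OF l]], of 0] by (simp add: state_map_zero xl_0)
    have "xl l n * cnj (xl l n) = 1" for n
      using complex_norm_square[of "xl l n"] norm_xl[OF l] by simp
    then have "(\<lambda>n. (xl l n - 1) * cnj (xl l n - 1)) = (\<lambda>n. (2 - xl l n) - cnj (xl l n))"
      by (simp add: fun_eq_iff algebra_simps)
    then have "e (\<lambda>n. (xl l n - 1) * cnj (xl l n - 1)) = 0"
      using l by (simp add: state_diff[OF es] state_const[OF es] state_cnj[OF es] ex)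
    then have "\<omega> (\<lambda>n. xl l n - 1) = 0" using l by (intro null) auto
    then show ?thesis using l by (simp add: state_diff[OF s] state_const[OF s])
  qed
  then show ?thesis using character_fixes_AP[OF \<omega>] s by (simp add: AP_states_def)
qed

lemma sigma_eq_circle:
  assumes "\<And>a. a \<in> AP \<Longrightarrow> \<Phi> a = a" shows "sigma \<Phi> = circle"
proof -
  have "coef \<Phi> l = 1" if l: "l \<in> circle" for l
    unfolding coef_def assms[OF xl_in_AP[OF l]]
  proof (rule the_equality)
    fix c assume "xl l = (\<lambda>n. c * xl l n)"
    from fun_cong[OF this, of 0] show "c = 1" by (simp add: xl_0)
  qed simp
  then show ?thesis by (auto simp: sigma_def)
qed

text \<open>A minimal projection onto \<open>linf\<close> would be the identity. Every projection
  lies below the identity, so minimality would make \<open>\<Phi>\<close> the identity as well,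
  against its vanishing on the point mass at 0.\<close>

lemma range_psubset_linf:
  assumes e: "zproj AP \<Phi>" and c0: "\<And>f. f \<in> c0 \<Longrightarrow> \<Phi> f = (\<lambda>_. 0)" and \<psi>: "min_zproj AP \<psi>"
  shows "\<psi> ` linf \<subset> linf"
proof -
  have sub: "\<psi> ` linf \<subseteq> linf"
  proof -
    have "lin_map \<psi>" using \<psi> unfolding min_zproj_def zproj_def ucp_def by (elim conjE)
    then have "\<forall>f\<in>linf. \<psi> f \<in> linf" unfolding lin_map_def by (rule conjunct1)
    then show ?thesis by (simp add: image_subset_iff)
  qed
  moreover have "\<psi> ` linf \<noteq> linf"
  proof
    assume eq: "\<psi> ` linf = linf"
    have id: "\<psi> f = f" if "f \<in> linf" for f
    proof -
      have "f \<in> \<psi> ` linf" using that eq by simp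
      then obtain g where "g \<in> linf" "f = \<psi> g" by (elim imageE)
      moreover have "idempotent \<psi>" using \<psi> unfolding min_zproj_def zproj_def by (elim conjE)
      ultimately show ?thesis by (simp add: idempotent_def)
    qed
    have "proj_le \<Phi> \<psi>"
      unfolding proj_le_def
    proof (intro ballI conjI)
      fix f assume f: "f \<in> linf"
      have "lin_map \<Phi>" using e unfolding zproj_def ucp_def by (elim conjE)
      then have "\<Phi> f \<in> linf" using f unfolding lin_map_def by blast
      then show "\<psi> (\<Phi> f) = \<Phi> f" by (rule id)
      show "\<Phi> (\<psi> f) = \<Phi> f" using id[OF f] by simp
    qed
    then have "\<forall>f\<in>linf. \<Phi> f = \<psi> f" using \<psi> e unfolding min_zproj_def by blast
    then have fix_all: "\<Phi> f = f" if "f \<in> linf" for f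
      using id that by simp
    define d where "d = (\<lambda>n::int. if n = 0 then 1 else 0 :: complex)"
    have "\<forall>\<^sub>F n in cofinite. d n = 0"
      unfolding eventually_cofinite d_def by simp
    then have "d \<in> c0" unfolding c0_def by (simp add: tendsto_eventually)
    then have "d = (\<lambda>_. 0)" using c0 c0_linf fix_all by (metis subsetD)
    from fun_cong[OF this, of 0] show False by (simp add: d_def)
  qed
  ultimately show ?thesis by blast
qed

theorem theorem2p16:
  shows "(\<forall>\<psi>. min_zproj AP \<psi> \<longrightarrow> \<psi> ` linf \<subset> linf) \<and>
    (\<exists>\<Phi>. ucp \<Phi> \<and> idempotent \<Phi> \<and> equivariant \<Phi> \<and>
       cstar_sub (\<Phi> ` linf) \<and>
       (\<exists>\<psi>. min_zproj AP \<psi> \<and> star_iso_env \<psi> (\<Phi> ` linf)) \<and>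
       (\<forall>a\<in>AP. \<Phi> a = a) \<and>
       (\<forall>f\<in>c0. \<Phi> f = (\<lambda>_. 0)) \<and>
       sigma \<Phi> = circle)"
proof -
  obtain e where e: "e \<in> AP_states" and rigid: "\<And>\<phi> f. \<phi> \<in> AP_states \<Longrightarrow> state_map e (state_map \<phi> (state_map e f)) = state_map e f"
    and ec0: "\<And>f. f \<in> c0 \<Longrightarrow> state_map e f = (\<lambda>_. 0)"
    by (rule rigid_state_c0) blast
  have es: "state e" using e by (rule AP_states_state)
  have el: "state_map e f \<in> linf" for f using state_map_linf[OF es] .
  have idem: "state_map e (state_map e f) = state_map e f" for f
  proof -
    \<comment> \<open>Evaluation at 0 is the unit of the semigroup, and rigidity at the unit is
      idempotence.\<close>
    let ?d = "\<lambda>f. if f \<in> linf then f 0 else (0::complex)"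
    have d: "state_map ?d f = f" if "f \<in> linf" for f using that by (simp add: state_map_def translate_apply)
    then have "?d \<in> AP_states"
      using character_eval[of 0] AP_linf by (auto simp: AP_states_def character_def)
    from rigid[OF this, of f] show ?thesis by (simp add: d el)
  qed
  have min: "min_zproj AP (state_map e)" using e rigid idem by (rule min_zproj_rigid)
  obtain \<omega> where \<omega>: "character \<omega>"
    and null: "\<And>f. f \<in> linf \<Longrightarrow> e (\<lambda>n. f n * cnj (f n)) = 0 \<Longrightarrow> \<omega> f = 0"
    using state_support_character[OF es] by blast
  have \<omega>AP_states: "\<omega> \<in> AP_states" using e \<omega> null by (rule support_character_in_AP_states)
  have \<omega>s: "state \<omega>" using \<omega>AP_states by (rule AP_states_state)
  have \<omega>t: "state (\<lambda>f. state_map \<omega> f n)" for n using state_translate[OF \<omega>s] by (simp add: state_map_def)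
  define \<theta> where "\<theta> = state_map \<omega>"
  define \<rho> where "\<rho> = conv \<omega> e"
  define \<Phi> where "\<Phi> = state_map \<rho>"
  have \<Phi>: "\<Phi> f = \<theta> (state_map e f)" for f by (simp add: \<Phi>_def \<rho>_def \<theta>_def state_map_conv)
  have \<rho>AP_states: "\<rho> \<in> AP_states" unfolding \<rho>_def using \<omega>AP_states e by (rule AP_states_conv)
  \<comment> \<open>This gives both the injectivity of \<open>\<theta>\<close> on the range of
    \<open>e\<close> and the idempotence of \<open>\<Phi>\<close>.\<close>
  have \<theta>_inv: "state_map e (\<theta> (state_map e f)) = state_map e f" for f
    unfolding \<theta>_def by (rule rigid[OF \<omega>AP_states])
  have \<Phi>_idem: "\<Phi> (\<Phi> f) = \<Phi> f" for f by (simp add: \<Phi> \<theta>_inv)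
  have \<Phi>l: "\<Phi> f \<in> linf" for f unfolding \<Phi>_def by (rule state_map_linf[OF AP_states_state[OF \<rho>AP_states]])
  \<comment> \<open>The defect \<open>?h\<close> between the two products is null at every
    coordinate, so \<open>\<omega>\<close> kills all its translates; \<open>\<theta>\<close>
    therefore does not distinguish the products, and it is multiplicative for the pointwise
    one.\<close>
  have \<theta>_mult: "\<theta> (state_map e (\<lambda>n. f n * g n)) = (\<lambda>n. \<theta> f n * \<theta> g n)"
    if f: "f \<in> linf" "state_map e f = f" and g: "g \<in> linf" "state_map e g = g" for f g
  proof -
    let ?h = "\<lambda>n. f n * g n - state_map e (\<lambda>n. f n * g n) n"
    have fg: "(\<lambda>n. f n * g n) \<in> linf" using f g by simp
    have "state_map \<omega> ?h n = 0" for n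
      unfolding state_map_def[of \<omega>]
    proof (rule null)
      show "translate n ?h \<in> linf" using fg el by simp
      have "state_map e (\<lambda>m. ?h m * cnj (?h m)) n = 0"
        using choi_effros_null[OF es idem f g] by simp
      then show "e (\<lambda>m. translate n ?h m * cnj (translate n ?h m)) = 0"
        by (simp only: state_map_def[of e "\<lambda>m. ?h m * cnj (?h m)"] translate_def)
    qed
    then have "\<theta> (state_map e (\<lambda>n. f n * g n)) = \<theta> (\<lambda>n. f n * g n)"
      using state_diff[OF \<omega>t fg el] by (simp add: \<theta>_def fun_eq_iff)
    then show ?thesis using f g by (simp add: \<theta>_def character_mult[OF \<omega>])
  qed
  have range_e: "f \<in> linf \<and> state_map e f = f" if "f \<in> state_map e ` linf" for f
    using that el idem by auto
  have range_\<Phi>: "\<Phi> ` linf = {f \<in> linf. \<Phi> f = f}"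
    using \<Phi>_idem \<Phi>l by force
  have "cstar_sub (\<Phi> ` linf)"
    unfolding range_\<Phi> unfolding \<Phi>_def
  proof (rule cstar_sub_fixed_points[OF AP_states_state[OF \<rho>AP_states]], fold \<Phi>_def)
    fix f g assume "\<Phi> f = f" "\<Phi> g = g"
    \<comment> \<open>Fixed points of \<open>\<Phi>\<close> have the form
      \<open>\<theta> (state_map e f)\<close>, so by \<open>\<theta>_mult\<close> their product is
      again a value of \<open>\<Phi>\<close>, hence fixed.\<close>
    then have "(\<lambda>n. f n * g n) = (\<lambda>n. \<theta> (state_map e f) n * \<theta> (state_map e g) n)" by (simp add: \<Phi>)
    also have "\<dots> = \<Phi> (\<lambda>n. state_map e f n * state_map e g n)"
      unfolding \<Phi> using el idem by (intro \<theta>_mult[symmetric])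
    finally show "\<Phi> (\<lambda>n. f n * g n) = (\<lambda>n. f n * g n)" by (simp add: \<Phi>_idem)
  qed
  moreover have "star_iso_env (state_map e) (\<Phi> ` linf)"
    unfolding star_iso_env_def
  proof (intro exI[of _ \<theta>] conjI ballI allI)
    have "inj_on \<theta> (state_map e ` linf)" by (rule inj_on_inverseI[of _ "state_map e"]) (auto simp: \<theta>_inv)
    moreover have "\<theta> ` (state_map e ` linf) = \<Phi> ` linf" by (simp add: image_image \<Phi>)
    ultimately show "bij_betw \<theta> (state_map e ` linf) (\<Phi> ` linf)" by (simp add: bij_betw_def)
  qed (auto simp: fun_eq_iff \<theta>_def state_lin[OF \<omega>t] state_cnj[OF \<omega>t] el
        \<theta>_mult[unfolded \<theta>_def] idem)
  moreover have "\<Phi> a = a" if "a \<in> AP" for a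
    unfolding \<Phi>_def using AP_states_AP[OF \<rho>AP_states that] .
  moreover have "\<Phi> f = (\<lambda>_. 0)" if "f \<in> c0" for f
    using state_zero[OF \<omega>t] by (simp add: \<Phi> ec0[OF that] \<theta>_def fun_eq_iff)
  moreover have "ucp \<Phi>" "equivariant \<Phi>" "idempotent \<Phi>"
    unfolding \<Phi>_def idempotent_def
    using ucp_state_map[OF AP_states_state[OF \<rho>AP_states]] equivariant_state_map \<Phi>_idem by (auto simp: \<Phi>_def)
  moreover have "\<psi> ` linf \<subset> linf" if "min_zproj AP \<psi>" for \<psi>
    using min ec0 that by (intro range_psubset_linf[of "state_map e"]) (auto simp: min_zproj_def)
  ultimately show ?thesis
    using min sigma_eq_circle[of \<Phi>] by blast
qed

end
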